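(* Let $0<\delta<\varepsilon$ and let $A=\{f\in\Omega : h(f,f_0)>\varepsilon\}$. Let $\{f_j\}$ be a countable set of densities with $h(f_j,f_0)>\varepsilon$ for all $j$, and let $\{A_j\}$ be a countable collection of pairwise disjoint (measurable) sets of densities whose union covers $A$ and such that $A_j\subseteq\{f : h(f,f_j)<\delta\}$ for every $j$. If the prior $\Pi$ has the Kullback–Leibler property, i.e. $\Pi(\{f : D(f,f_0)<\eta\})>0$ for every $\eta>0$, and $$\sum_j\sqrt{\Pi(A_j)}<\infty,$$ then $$\Pi^n(A)\to 0\qquad\text{a.s. } [F_0^\infty]\text{ as } n\to\infty.$$
   Context: Let $X_1,X_2,\ldots$, taking values in $(\mathscr{X},\mathscr{B})$, be i.i.d. with fixed density $f_0$ (with respect to Lebesgue measure) and distribution $F_0$; $F_0^\infty$ is the infinite product measure. $\Omega$ is the space of density functions (with respect to Lebesgue measure) on $(\mathscr{X},\mathscr{B})$, and the prior $\Pi$ is a probability distribution on $\Omega$. Put $R_n(f)=\prod_{i=1}^n f(X_i)/f_0(X_i)$. The posterior is $$\Pi^n(A)=\frac{\int_A R_n(f)\,\Pi(df)}{\int R_n(f)\,\Pi(df)} .$$ The Kullback–Leibler divergence is $D(f,f_0)=\int f_0\log(f_0/f)$. For densities $f,g$, $h(f,g)=1-\int\sqrt{fg}=H^2(f,g)/2$, where $H(f,g)=\{\int(\sqrt f-\sqrt g)^2\}^{1/2}$ is the Hellinger distance. *)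

theory Defs
  imports "HOL-Probability.Probability"
begin

text \<open>Densities are extensional, so that they are literally functions
  \<open>space \<mu> \<Rightarrow> [0, \<infinity>)\<close>.\<close>

definition prob_densities :: "'a measure \<Rightarrow> ('a \<Rightarrow> real) set" where
  "prob_densities \<mu> =
    {f \<in> space \<mu> \<rightarrow>\<^sub>E {0..}. f \<in> borel_measurable \<mu> \<and> (\<integral>\<^sup>+ x. ennreal (f x) \<partial>\<mu>) = 1}"

text \<open>Half of the squared Hellinger distance.\<close>

definition hell :: "'a measure \<Rightarrow> ('a \<Rightarrow> real) \<Rightarrow> ('a \<Rightarrow> real) \<Rightarrow> real" where
  "hell \<mu> f g = 1 - (\<integral> x. sqrt (f x * g x) \<partial>\<mu>)"

text \<open>The integrand \<open>f\<^sub>0 log (f\<^sub>0 / f)\<close> with the conventions \<open>0 log (0 / f) = 0\<close> and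
  \<open>f\<^sub>0 log (f\<^sub>0 / 0) = \<infinity>\<close> for \<open>f\<^sub>0 > 0\<close>.\<close>

definition kl_integrand :: "('a \<Rightarrow> real) \<Rightarrow> ('a \<Rightarrow> real) \<Rightarrow> 'a \<Rightarrow> ereal" where
  "kl_integrand f f0 x =
    (if f0 x = 0 then 0 else if f x = 0 then \<infinity> else ereal (f0 x * ln (f0 x / f x)))"

text \<open>The integral is taken in the extended sense, as positive minus negative part: the library's
  \<open>KL_divergence\<close> is a Bochner integral and would assign the value \<open>0\<close> to an infinite
  divergence.  For densities the negative part has integral at most \<open>1\<close>, so \<open>\<infinity> - \<infinity>\<close>
  does not occur.  (\<open>e2ennreal\<close> maps negative numbers to \<open>0\<close>.)\<close>

definition kl_div :: "'a measure \<Rightarrow> ('a \<Rightarrow> real) \<Rightarrow> ('a \<Rightarrow> real) \<Rightarrow> ereal" where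
  "kl_div \<mu> f f0 =
    enn2ereal (\<integral>\<^sup>+ x. e2ennreal (kl_integrand f f0 x) \<partial>\<mu>) -
    enn2ereal (\<integral>\<^sup>+ x. e2ennreal (- kl_integrand f f0 x) \<partial>\<mu>)"

text \<open>The observations are the coordinates \<open>\<omega> 0, \<omega> 1, \<dots>\<close> of a point of the infinite
  product space.\<close>

definition lik_ratio :: "('a \<Rightarrow> real) \<Rightarrow> nat \<Rightarrow> (nat \<Rightarrow> 'a) \<Rightarrow> ('a \<Rightarrow> real) \<Rightarrow> real" where
  "lik_ratio f0 n \<omega> f = (\<Prod>i<n. f (\<omega> i) / f0 (\<omega> i))"

definition posterior ::
  "('a \<Rightarrow> real) measure \<Rightarrow> ('a \<Rightarrow> real) \<Rightarrow> nat \<Rightarrow> (nat \<Rightarrow> 'a) \<Rightarrow> ('a \<Rightarrow> real) set \<Rightarrow> ennreal"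
where
  "posterior Prior f0 n \<omega> A =
    (\<integral>\<^sup>+ f\<in>A. (ennreal (lik_ratio f0 n \<omega> f)) \<partial>Prior) / (\<integral>\<^sup>+ f. ennreal (lik_ratio f0 n \<omega> f) \<partial>Prior)"

text \<open>A prior is a probability measure carried by a set of densities on which the evaluation
  \<open>(f, x) \<mapsto> f x\<close> is jointly measurable, so that the posterior is well defined.  The carrier
  \<open>space Prior\<close> is only required to be a subset of the set of all densities: densities are
  functions and not classes modulo null sets, and on the set of all Borel densities (which have
  unbounded Baire class) no \<open>\<sigma>\<close>-algebra makes evaluation jointly measurable.  A probability
  measure on the \<open>L\<^sup>1\<close>-classes of densities is covered by choosing a jointly measurable
  system of representatives.\<close>

definition prior_on :: "'a measure \<Rightarrow> ('a \<Rightarrow> real) measure \<Rightarrow> bool" where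
  "prior_on \<mu> Prior \<longleftrightarrow>
    prob_space Prior \<and> space Prior \<subseteq> prob_densities \<mu> \<and>
    (\<lambda>(f, x). f x) \<in> borel_measurable (Prior \<Otimes>\<^sub>M \<mu>)"

definition kl_property :: "'a measure \<Rightarrow> ('a \<Rightarrow> real) measure \<Rightarrow> ('a \<Rightarrow> real) \<Rightarrow> bool" where
  "kl_property \<mu> Prior f0 \<longleftrightarrow>
    (\<forall>\<eta>::real. \<eta> > 0 \<longrightarrow> measure Prior {f \<in> space Prior. kl_div \<mu> f f0 < ereal \<eta>} > 0)"

end

theory Submission
  imports Defs
begin

text \<open>Write $R_n(f)$ for the likelihood ratio.  The posterior mass of \<open>A\<close> is the quotient of
$\int_A R_n\,d\Pi$ by $\int R_n\,d\Pi$, and for a suitable \<open>\<eta> > 0\<close> both are compared with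
$e^{-2\eta n}$: multiplied by $e^{2\eta n}$, the numerator tends to \<open>0\<close> and the denominator
is eventually larger than \<open>1\<close>, almost surely.

\<^bold>\<open>Numerator.\<close>  For a finite measure \<open>Q\<close> on densities, put $L_n = \int R_n\,dQ$.  Conditionally on one
observation \<open>x\<close>, the remaining product is again such an integral, for the measure reweighted by
$f(x)/f_0(x)$.  So the expectation of $\sqrt{L_n}$ is controlled by one step, iterated: that step is
the affinity $\int\sqrt{p f_0}$ of \<open>f0\<close> with the mixture $p = \int f\,Q(df)$.  If \<open>Q\<close> lives on
densities within \<open>\<delta>\<close> of \<open>g\<close>, then the normalized mixture is within \<open>\<delta>\<close> of \<open>g\<close> as well
(\<open>hell_mixture_le\<close>: the affinity is concave, by the Cauchy--Schwarz inequality).  If moreover \<open>g\<close>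
is at distance more than \<open>\<epsilon> > \<delta>\<close> from \<open>f0\<close>, the triangle inequality keeps the mixture at a
distance \<open>\<gamma> > 0\<close> from \<open>f0\<close> that depends only on \<open>\<delta>\<close> and \<open>\<epsilon>\<close> (\<open>hell_separation\<close>).  Hence
$E\sqrt{L_n} \le (1-\gamma)^n \sqrt{Q(\mbox{space})}$ (\<open>expectation_sqrt_marginal_le\<close>).  Applied to the
prior restricted to each of the sets $A_j$ and summed over \<open>j\<close> and \<open>n\<close>, with
$\sum_j \sqrt{\Pi(A_j)} < \infty$, this bounds an expectation, and the almost sure finiteness of the
sum gives the decay (\<open>covered_marginal_decay\<close>).

\<^bold>\<open>Denominator.\<close>  If $D(f,f_0) < \eta$, then $\ln(f_0/f) - \eta$ has negative mean under $f_0$, so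
its partial sums along the observations are almost surely bounded above
(\<open>negative_drift_walk_bdd_above\<close>).  Therefore $e^{2\eta n} R_n(f)$ tends to infinity for each such
\<open>f\<close>.  The Kullback--Leibler property says that such \<open>f\<close> have positive prior mass, and Fatou's
lemma yields the bound for the integral (\<open>marginal_lower_bound\<close>).\<close>

section \<open>Splitting off the first observation of an i.i.d. sequence\<close>

context sequence_space
begin

lemma measurable_shift [measurable]: "(\<lambda>\<omega> i. \<omega> (Suc i)) \<in> S \<rightarrow>\<^sub>M S"
  by (rule measurable_PiM_single') (auto simp: space_PiM)

text \<open>The first observation is independent of the shifted sequence, which has the same law as the whole
sequence.  Both the iteration over observations and the random walk argument rest on this.\<close>

lemma distr_uncons: "distr S (M \<Otimes>\<^sub>M S) (\<lambda>\<omega>. (\<omega> 0, \<lambda>i. \<omega> (Suc i))) = M \<Otimes>\<^sub>M S"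
proof -
  have m: "(\<lambda>\<omega>. (\<omega> 0, \<lambda>i. \<omega> (Suc i))) \<in> S \<rightarrow>\<^sub>M M \<Otimes>\<^sub>M S"
    by (intro measurable_Pair measurable_shift) simp
  have "distr S (M \<Otimes>\<^sub>M S) (\<lambda>\<omega>. (\<omega> 0, \<lambda>i. \<omega> (Suc i))) =
    distr (distr (M \<Otimes>\<^sub>M S) S (\<lambda>(s, \<omega>). case_nat s \<omega>)) (M \<Otimes>\<^sub>M S) (\<lambda>\<omega>. (\<omega> 0, \<lambda>i. \<omega> (Suc i)))"
    by (simp add: PiM_iter)
  also have "\<dots> = distr (M \<Otimes>\<^sub>M S) (M \<Otimes>\<^sub>M S) (\<lambda>x. x)"
    by (subst distr_distr[OF m]) (auto intro!: distr_cong simp: comp_def split_beta')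
  finally show ?thesis by simp
qed

lemma measurable_uncons: "(\<lambda>\<omega>. (\<omega> 0, \<lambda>i. \<omega> (Suc i))) \<in> S \<rightarrow>\<^sub>M M \<Otimes>\<^sub>M S"
  by (intro measurable_Pair measurable_shift) simp

lemma nn_integral_uncons:
  assumes [measurable]: "F \<in> borel_measurable S"
  shows "(\<integral>\<^sup>+\<omega>. F \<omega> \<partial>S) = (\<integral>\<^sup>+x. \<integral>\<^sup>+\<omega>. F (case_nat x \<omega>) \<partial>S \<partial>M)"
proof -
  have "(\<integral>\<^sup>+\<omega>. F \<omega> \<partial>S) = (\<integral>\<^sup>+\<omega>. F \<omega> \<partial>distr (M \<Otimes>\<^sub>M S) S (\<lambda>(s, \<omega>). case_nat s \<omega>))"
    by (simp add: PiM_iter)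
  also have "\<dots> = (\<integral>\<^sup>+p. F (case_nat (fst p) (snd p)) \<partial>(M \<Otimes>\<^sub>M S))"
    by (subst nn_integral_distr) (auto simp: case_prod_beta)
  also have "\<dots> = (\<integral>\<^sup>+x. \<integral>\<^sup>+\<omega>. F (case_nat x \<omega>) \<partial>S \<partial>M)"
    by (subst P.nn_integral_fst[symmetric]) auto
  finally show ?thesis .
qed

lemma distr_shift: "distr S S (\<lambda>\<omega> i. \<omega> (Suc i)) = S"
proof (rule measure_eqI)
  fix A assume "A \<in> sets (distr S S (\<lambda>\<omega> i. \<omega> (Suc i)))"
  then have A [measurable]: "A \<in> sets S" by simp
  have "emeasure (distr S S (\<lambda>\<omega> i. \<omega> (Suc i))) A
      = (\<integral>\<^sup>+\<omega>. indicator A (\<lambda>i. \<omega> (Suc i)) \<partial>S)"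
    by (subst nn_integral_indicator[symmetric], simp, subst nn_integral_distr) auto
  also have "\<dots> = emeasure S A"
    by (subst nn_integral_uncons) (auto simp: M.emeasure_space_1 intro: measurable_compose[OF measurable_shift])
  finally show "emeasure (distr S S (\<lambda>\<omega> i. \<omega> (Suc i))) A = emeasure S A" .
qed simp

lemma integrable_coordinate:
  fixes Y :: "'a \<Rightarrow> real"
  assumes "integrable M Y" shows "integrable S (\<lambda>\<omega>. Y (\<omega> i))"
proof -
  have "distr S M (\<lambda>\<omega>. \<omega> i) = M"
    by (rule distr_PiM_component) (auto intro: M.prob_space_axioms)
  then have "integrable (distr S M (\<lambda>\<omega>. \<omega> i)) Y"
    using assms by simp
  then show ?thesis
    by (subst (asm) integrable_distr_eq) (auto intro: borel_measurable_integrable[OF assms])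
qed

lemma integrable_shift:
  fixes F :: "(nat \<Rightarrow> 'a) \<Rightarrow> real"
  assumes "integrable S F" shows "integrable S (\<lambda>\<omega>. F (\<lambda>i. \<omega> (Suc i)))"
proof -
  have "integrable (distr S S (\<lambda>\<omega> i. \<omega> (Suc i))) F"
    using assms by (simp only: distr_shift)
  then show ?thesis
    by (subst (asm) integrable_distr_eq) (auto intro: borel_measurable_integrable[OF assms])
qed

lemma integral_shift:
  fixes F :: "(nat \<Rightarrow> 'a) \<Rightarrow> real"
  assumes [measurable]: "F \<in> borel_measurable S"
  shows "(\<integral>\<omega>. F (\<lambda>i. \<omega> (Suc i)) \<partial>S) = (\<integral>\<omega>. F \<omega> \<partial>S)"
proof -
  have "(\<integral>\<omega>. F (\<lambda>i. \<omega> (Suc i)) \<partial>S) = (\<integral>\<omega>. F \<omega> \<partial>distr S S (\<lambda>\<omega> i. \<omega> (Suc i)))"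
    by (rule integral_distr[symmetric]) auto
  then show ?thesis by (simp only: distr_shift)
qed

end

section \<open>Random walks with negative drift\<close>

text \<open>The maximum of \<open>0\<close> and the first \<open>n\<close> partial sums of \<open>Y (\<omega> 0), Y (\<omega> 1), \<dots>\<close>, by the
recursion of Lindley.  The recursion removes the first step, not the last one, so that it relates
the walk along \<open>\<omega>\<close> to the walk along the shifted sequence.\<close>

primrec walk_max :: "('a \<Rightarrow> real) \<Rightarrow> nat \<Rightarrow> (nat \<Rightarrow> 'a) \<Rightarrow> real" where
  "walk_max Y 0 \<omega> = 0"
| "walk_max Y (Suc n) \<omega> = max 0 (Y (\<omega> 0) + walk_max Y n (\<lambda>i. \<omega> (Suc i)))"

lemma walk_max_Suc:
  "walk_max Y (Suc n) = (\<lambda>\<omega>. max 0 (Y (\<omega> 0) + walk_max Y n (\<lambda>i. \<omega> (Suc i))))"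
  by (rule ext) simp

lemma walk_max_0: "walk_max Y 0 = (\<lambda>\<omega>. 0)"
  by (rule ext) simp

lemma walk_max_nonneg: "0 \<le> walk_max Y n \<omega>"
  by (cases n) auto

lemma walk_max_Suc_mono: "walk_max Y n \<omega> \<le> walk_max Y (Suc n) \<omega>"
proof (induction n arbitrary: \<omega>)
  case (Suc n)
  have "walk_max Y n (\<lambda>i. \<omega> (Suc i)) \<le> walk_max Y (Suc n) (\<lambda>i. \<omega> (Suc i))" by (rule Suc)
  then show ?case by (simp only: walk_max.simps(2)[where \<omega> = \<omega>])
qed auto

lemma sum_le_walk_max: "(\<Sum>i<n. Y (\<omega> i)) \<le> walk_max Y n \<omega>"
proof (induction n arbitrary: \<omega>)
  case (Suc n)
  show ?case
    using Suc[of "\<lambda>i. \<omega> (Suc i)"] by (simp add: sum.lessThan_Suc_shift del: sum.lessThan_Suc)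
qed auto

text \<open>The two walks differ by the fixed step \<open>Y (\<omega> 0)\<close>.  Unboundedness is therefore a shift-invariant
event, and so it does not depend on the first coordinate.\<close>

lemma bdd_above_walk_max_shift:
  "bdd_above (range (\<lambda>n. walk_max Y n (\<lambda>i. \<omega> (Suc i)))) \<longleftrightarrow> bdd_above (range (\<lambda>n. walk_max Y n \<omega>))"
proof
  assume "bdd_above (range (\<lambda>n. walk_max Y n (\<lambda>i. \<omega> (Suc i))))"
  then obtain C where C: "\<And>n. walk_max Y n (\<lambda>i. \<omega> (Suc i)) \<le> C"
    by (auto simp: bdd_above_def)
  have "walk_max Y n \<omega> \<le> max 0 (Y (\<omega> 0) + C)" for n
    using C[of "n - 1"] by (cases n) auto
  then show "bdd_above (range (\<lambda>n. walk_max Y n \<omega>))"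
    by (intro bdd_aboveI2)
next
  assume "bdd_above (range (\<lambda>n. walk_max Y n \<omega>))"
  then obtain C where C: "\<And>n. walk_max Y n \<omega> \<le> C"
    by (auto simp: bdd_above_def)
  have "walk_max Y n (\<lambda>i. \<omega> (Suc i)) \<le> C - Y (\<omega> 0)" for n
    using C[of "Suc n"] by simp
  then show "bdd_above (range (\<lambda>n. walk_max Y n (\<lambda>i. \<omega> (Suc i))))"
    by (intro bdd_aboveI2)
qed

context sequence_space
begin

lemma walk_max_measurable [measurable]:
  assumes [measurable]: "Y \<in> borel_measurable M"
  shows "walk_max Y n \<in> borel_measurable S"
proof (induction n)
  case (Suc n)
  note [measurable] = Suc
  have "(\<lambda>\<omega>. walk_max Y n (\<lambda>i. \<omega> (Suc i))) \<in> borel_measurable S"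
    by (rule measurable_compose[OF measurable_shift Suc])
  then have "(\<lambda>\<omega>. max 0 (Y (\<omega> 0) + walk_max Y n (\<lambda>i. \<omega> (Suc i)))) \<in> borel_measurable S"
    by measurable
  then show ?case by (simp only: walk_max_Suc)
qed (simp add: walk_max_0)

lemma integrable_walk_max:
  assumes "integrable M Y" shows "integrable S (walk_max Y n)"
proof (induction n)
  case (Suc n)
  have "integrable S (\<lambda>\<omega>. Y (\<omega> 0) + walk_max Y n (\<lambda>i. \<omega> (Suc i)))"
    using integrable_coordinate[OF assms, of 0] integrable_shift[OF Suc] by simp
  then have "integrable S (\<lambda>\<omega>. max 0 (Y (\<omega> 0) + walk_max Y n (\<lambda>i. \<omega> (Suc i))))"
    by (intro integrable_max) simp_all
  then show ?case by (simp only: walk_max_Suc)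
qed (simp add: walk_max_0)

text \<open>This one-sided form of the strong law of large numbers follows from the argument behind the maximal
ergodic lemma.  Let \<open>B\<close> be the event that the walk is unbounded above.  The increments
$M_{n+1} - M_n \circ \mathrm{shift}$ of the running maxima have nonnegative integral over \<open>B\<close>, since
\<open>B\<close> and the law are shift-invariant and the maxima increase with \<open>n\<close>.  On \<open>B\<close> they are
dominated by \<open>\<bar>Y (\<omega> 0)\<bar>\<close> and eventually equal to \<open>Y (\<omega> 0)\<close>.  So $E[Y(\omega_0) 1_B] \ge 0$.
By independence the left side is $E[Y] P(B)$ with $E[Y] < 0$, which forces $P(B) = 0$.\<close>

lemma negative_drift_walk_bdd_above:
  fixes Y :: "'a \<Rightarrow> real"
  assumes Y: "integrable M Y" and neg: "(\<integral>x. Y x \<partial>M) < 0"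
  shows "AE \<omega> in S. bdd_above (range (\<lambda>n. \<Sum>i<n. Y (\<omega> i)))"
proof -
  have [measurable]: "Y \<in> borel_measurable M" using Y by (rule borel_measurable_integrable)
  define B where "B = {\<omega> \<in> space S. \<not> bdd_above (range (\<lambda>n. walk_max Y n \<omega>))}"
  define u where "u = (indicator B :: _ \<Rightarrow> real)"
  have B_alt: "B = {\<omega> \<in> space S. \<forall>k::nat. \<exists>n. walk_max Y n \<omega> > real k}"
  proof -
    have "\<not> bdd_above (range (\<lambda>n. walk_max Y n \<omega>)) \<longleftrightarrow> (\<forall>k::nat. \<exists>n. walk_max Y n \<omega> > real k)" for \<omega>
    proof -
      have "bdd_above (range (\<lambda>n. walk_max Y n \<omega>)) \<longleftrightarrow> (\<exists>k::nat. \<forall>n. walk_max Y n \<omega> \<le> real k)"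
        unfolding bdd_above_def by (auto, meson order.trans real_arch_simple)
      then show ?thesis by (simp add: not_le)
    qed
    then show ?thesis by (auto simp: B_def)
  qed
  have B[measurable]: "B \<in> sets S" unfolding B_alt by measurable
  have u_shift: "u (\<lambda>i. \<omega> (Suc i)) = u \<omega>" if "\<omega> \<in> space S" for \<omega>
  proof -
    have "(\<lambda>i. \<omega> (Suc i)) \<in> space S" using that by (auto simp: space_PiM)
    then show ?thesis using that unfolding u_def B_def
      by (auto simp: indicator_def bdd_above_walk_max_shift)
  qed
  have [measurable]: "u \<in> borel_measurable S" unfolding u_def by measurable
  have int_u: "integrable S (\<lambda>\<omega>. F \<omega> * u \<omega>)" if "integrable S F" for F :: "_ \<Rightarrow> real"
    unfolding u_def using integrable_mult_indicator[OF B that] by (simp add: mult.commute)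
  define d where "d n \<omega> = (walk_max Y (Suc n) \<omega> - walk_max Y n (\<lambda>i. \<omega> (Suc i))) * u \<omega>" for n \<omega>
  have d_eq: "d n \<omega> = max (- walk_max Y n (\<lambda>i. \<omega> (Suc i))) (Y (\<omega> 0)) * u \<omega>" for n \<omega>
    unfolding d_def by (simp add: max_def)
  have d_int: "0 \<le> (\<integral>\<omega>. d n \<omega> \<partial>S)" for n
  proof -
    have i1: "integrable S (\<lambda>\<omega>. walk_max Y (Suc n) \<omega> * u \<omega>)" "integrable S (\<lambda>\<omega>. walk_max Y n \<omega> * u \<omega>)"
      by (intro int_u integrable_walk_max Y)+
    have i2: "integrable S (\<lambda>\<omega>. walk_max Y n (\<lambda>i. \<omega> (Suc i)) * u \<omega>)"
      by (intro int_u integrable_shift integrable_walk_max Y)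
    have "(\<integral>\<omega>. walk_max Y n (\<lambda>i. \<omega> (Suc i)) * u \<omega> \<partial>S)
        = (\<integral>\<omega>. walk_max Y n (\<lambda>i. \<omega> (Suc i)) * u (\<lambda>i. \<omega> (Suc i)) \<partial>S)"
      by (intro Bochner_Integration.integral_cong refl) (simp add: u_shift)
    also have "\<dots> = (\<integral>\<omega>. walk_max Y n \<omega> * u \<omega> \<partial>S)"
      by (rule integral_shift) auto
    also have "\<dots> \<le> (\<integral>\<omega>. walk_max Y (Suc n) \<omega> * u \<omega> \<partial>S)"
      by (intro integral_mono i1 mult_right_mono walk_max_Suc_mono) (simp add: u_def)
    finally show ?thesis
      unfolding d_def left_diff_distrib using i1 i2 by (subst Bochner_Integration.integral_diff) auto
  qed
  have lim: "(\<lambda>n. \<integral>\<omega>. d n \<omega> \<partial>S) \<longlonglongrightarrow> (\<integral>\<omega>. Y (\<omega> 0) * u \<omega> \<partial>S)"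
  proof (rule integral_dominated_convergence[where w = "\<lambda>\<omega>. \<bar>Y (\<omega> 0)\<bar>"])
    show "d n \<in> borel_measurable S" for n
      unfolding d_def by measurable
    show "AE \<omega> in S. (\<lambda>n. d n \<omega>) \<longlonglongrightarrow> Y (\<omega> 0) * u \<omega>"
    proof (rule AE_I2)
      fix \<omega> assume "\<omega> \<in> space S"
      show "(\<lambda>n. d n \<omega>) \<longlonglongrightarrow> Y (\<omega> 0) * u \<omega>"
      proof (cases "\<omega> \<in> B")
        case True
        then have unbdd: "\<not> bdd_above (range (\<lambda>n. walk_max Y n (\<lambda>i. \<omega> (Suc i))))"
          by (simp add: B_def bdd_above_walk_max_shift)
        have "\<exists>N. walk_max Y N (\<lambda>i. \<omega> (Suc i)) > - Y (\<omega> 0)"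
        proof (rule ccontr)
          assume "\<not> ?thesis"
          then have "bdd_above (range (\<lambda>n. walk_max Y n (\<lambda>i. \<omega> (Suc i))))"
            by (intro bdd_aboveI2[where M = "- Y (\<omega> 0)"]) (simp add: not_less)
          with unbdd show False by (rule notE)
        qed
        then obtain N where N: "walk_max Y N (\<lambda>i. \<omega> (Suc i)) > - Y (\<omega> 0)"
          by (rule exE)
        have "d n \<omega> = Y (\<omega> 0) * u \<omega>" if "n \<ge> N" for n
        proof -
          have "walk_max Y N (\<lambda>i. \<omega> (Suc i)) \<le> walk_max Y n (\<lambda>i. \<omega> (Suc i))"
            using lift_Suc_mono_le[of "\<lambda>n. walk_max Y n (\<lambda>i. \<omega> (Suc i))", OF walk_max_Suc_mono that] . 
          then show ?thesis using N by (simp add: d_eq max_def)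
        qed
        then show ?thesis
          by (intro tendsto_eventually eventually_sequentiallyI[of N])
      next
        case False
        then show ?thesis by (simp add: d_eq u_def)
      qed
    qed
    show "AE \<omega> in S. norm (d n \<omega>) \<le> \<bar>Y (\<omega> 0)\<bar>" for n
    proof (rule AE_I2)
      fix \<omega>
      show "norm (d n \<omega>) \<le> \<bar>Y (\<omega> 0)\<bar>"
        using walk_max_nonneg[of Y n "\<lambda>i. \<omega> (Suc i)"]
        by (auto simp: d_eq u_def indicator_def)
    qed
  qed (use integrable_coordinate[OF Y, of 0] in auto)
  \<comment> \<open>By shift-invariance \<open>u\<close> is a function of the coordinates from \<open>1\<close> on, so the integral
    factorizes.\<close>
  have "0 \<le> (\<integral>\<omega>. Y (\<omega> 0) * u \<omega> \<partial>S)"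
    using d_int by (intro LIMSEQ_le_const[OF lim]) auto
  also have "\<dots> = (\<integral>\<omega>. Y (\<omega> 0) * u (\<lambda>i. \<omega> (Suc i)) \<partial>S)"
    by (intro Bochner_Integration.integral_cong refl) (simp add: u_shift)
  also have "\<dots> = (\<integral>p. Y (fst p) * u (snd p) \<partial>distr S (M \<Otimes>\<^sub>M S) (\<lambda>\<omega>. (\<omega> 0, \<lambda>i. \<omega> (Suc i))))"
    by (subst integral_distr[OF measurable_uncons]) auto
  also have "\<dots> = (\<integral>p. Y (fst p) * u (snd p) \<partial>(M \<Otimes>\<^sub>M S))"
    by (simp only: distr_uncons)
  also have "\<dots> = (\<integral>x. Y x \<partial>M) * measure S B"
  proof -
    interpret PS: pair_sigma_finite M S ..
    have "integrable S (\<lambda>\<omega>. Y (\<omega> 0) * u (\<lambda>i. \<omega> (Suc i)))"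
      using int_u[OF integrable_coordinate[OF Y, of 0]] u_shift
      by (subst Bochner_Integration.integrable_cong[OF refl, where g = "\<lambda>\<omega>. Y (\<omega> 0) * u \<omega>"]) (simp_all only:)
    then have "integrable (distr S (M \<Otimes>\<^sub>M S) (\<lambda>\<omega>. (\<omega> 0, \<lambda>i. \<omega> (Suc i)))) (\<lambda>p. Y (fst p) * u (snd p))"
      by (subst integrable_distr_eq[OF measurable_uncons]) auto
    then have "integrable (M \<Otimes>\<^sub>M S) (\<lambda>p. Y (fst p) * u (snd p))"
      by (simp only: distr_uncons)
    from PS.integral_fst'[OF this, symmetric] show ?thesis
      by (simp add: u_def Int_absorb2 sets.sets_into_space)
  qed
  finally have "measure S B = 0"
    using neg by (smt (verit) measure_nonneg mult_neg_pos)
  then have "AE \<omega> in S. \<omega> \<notin> B"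
    using B by (intro AE_not_in) (simp add: P.emeasure_eq_measure null_sets_def)
  with AE_space show ?thesis
  proof eventually_elim
    case (elim \<omega>)
    then obtain C where "\<And>n. walk_max Y n \<omega> \<le> C"
      by (auto simp: B_def bdd_above_def)
    then show ?case
      by (intro bdd_aboveI2[where M = C]) (metis sum_le_walk_max order.trans)
  qed
qed
end

section \<open>Hellinger distance\<close>

text \<open>Unlike the elements of \<open>prob_densities\<close>, these functions need not be extensional; mixtures of
densities fall into this class.\<close>

definition unit_density :: "'a measure \<Rightarrow> ('a \<Rightarrow> real) \<Rightarrow> bool" where
  "unit_density \<mu> f \<longleftrightarrow> integrable \<mu> f \<and> (\<forall>x\<in>space \<mu>. 0 \<le> f x) \<and> (\<integral>x. f x \<partial>\<mu>) = 1"

lemma unit_densityI: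
  assumes [measurable]: "f \<in> borel_measurable \<mu>" and nn: "\<And>x. x \<in> space \<mu> \<Longrightarrow> 0 \<le> f x"
    and one: "(\<integral>\<^sup>+x. ennreal (f x) \<partial>\<mu>) = 1"
  shows "unit_density \<mu> f"
proof -
  have ae: "AE x in \<mu>. 0 \<le> f x" using nn by auto
  have i: "integrable \<mu> f"
    using one ae by (intro integrableI_nonneg) auto
  have "ennreal (\<integral>x. f x \<partial>\<mu>) = 1"
    using nn_integral_eq_integral[OF i ae] one by simp
  then have "(\<integral>x. f x \<partial>\<mu>) = 1" by (simp add: ennreal_eq_1)
  with i nn show ?thesis by (simp add: unit_density_def)
qed

lemma unit_density_prob_densities: "f \<in> prob_densities \<mu> \<Longrightarrow> unit_density \<mu> f"
  by (rule unit_densityI) (auto simp: prob_densities_def PiE_iff)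

lemma integrable_sqrt_mult:
  assumes f: "unit_density \<mu> f" and g: "unit_density \<mu> g"
  shows "integrable \<mu> (\<lambda>x. sqrt (f x * g x))"
proof (rule Bochner_Integration.integrable_bound)
  show "integrable \<mu> (\<lambda>x. f x + g x)" using f g by (auto simp: unit_density_def)
  have [measurable]: "f \<in> borel_measurable \<mu>" "g \<in> borel_measurable \<mu>"
    using f g by (auto simp: unit_density_def)
  show "(\<lambda>x. sqrt (f x * g x)) \<in> borel_measurable \<mu>" by measurable
  show "AE x in \<mu>. norm (sqrt (f x * g x)) \<le> norm (f x + g x)"
  proof (rule AE_I2)
    fix x assume "x \<in> space \<mu>"
    then have "0 \<le> f x" "0 \<le> g x" using f g by (auto simp: unit_density_def)
    then show "norm (sqrt (f x * g x)) \<le> norm (f x + g x)"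
      using arith_geo_mean_sqrt[of "f x" "g x"] by simp
  qed
qed

text \<open>From $2|uv| \le t u^2 + v^2/t$, applied to $b - c = (a - c) - (a - b)$.\<close>

lemma sqrt_diff_weak_triangle:
  fixes a b c t :: real
  assumes t: "0 < t"
  shows "(b - c)\<^sup>2 \<le> (1 + t) * (a - b)\<^sup>2 + (1 + 1 / t) * (a - c)\<^sup>2"
proof -
  have "0 \<le> (t * (a - b) + (a - c))\<^sup>2 / t" using t by simp
  also have "\<dots> = t * (a - b)\<^sup>2 + 2 * (a - b) * (a - c) + (a - c)\<^sup>2 / t"
    using t by (simp add: power2_eq_square field_simps)
  finally have "0 \<le> t * (a - b)\<^sup>2 + 2 * (a - b) * (a - c) + (a - c)\<^sup>2 / t" .
  moreover have "(b - c)\<^sup>2 = (a - b)\<^sup>2 + (a - c)\<^sup>2 - 2 * (a - b) * (a - c)"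
    by (simp add: power2_eq_square algebra_simps)
  ultimately show ?thesis by (simp add: distrib_right)
qed

text \<open>The triangle inequality for the Hellinger distance $\sqrt{2h}$, squared and linearized: integrating
a pointwise inequality with a free parameter replaces the Minkowski inequality.\<close>

lemma hell_weak_triangle:
  assumes p: "unit_density \<mu> p" and g: "unit_density \<mu> g" and q: "unit_density \<mu> q" and t: "0 < t"
  shows "hell \<mu> g q \<le> (1 + t) * hell \<mu> p g + (1 + 1 / t) * hell \<mu> p q"
proof -
  have i: "integrable \<mu> p" "integrable \<mu> g" "integrable \<mu> q"
    and one: "(\<integral>x. p x \<partial>\<mu>) = 1" "(\<integral>x. g x \<partial>\<mu>) = 1" "(\<integral>x. q x \<partial>\<mu>) = 1"
    using p g q by (auto simp: unit_density_def)
  note s = integrable_sqrt_mult[OF p g] integrable_sqrt_mult[OF g q] integrable_sqrt_mult[OF p q]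
  have "(\<integral>x. g x + q x - 2 * sqrt (g x * q x) \<partial>\<mu>) \<le>
    (\<integral>x. (1 + t) * (p x + g x - 2 * sqrt (p x * g x)) + (1 + 1 / t) * (p x + q x - 2 * sqrt (p x * q x)) \<partial>\<mu>)"
  proof (rule integral_mono)
    fix x assume "x \<in> space \<mu>"
    then have nn: "0 \<le> p x" "0 \<le> g x" "0 \<le> q x" using p g q by (auto simp: unit_density_def)
    have sq: "u + v - 2 * sqrt (u * v) = (sqrt u - sqrt v)\<^sup>2" if "0 \<le> u" "0 \<le> v" for u v :: real
      using that by (simp add: power2_diff real_sqrt_mult)
    show "g x + q x - 2 * sqrt (g x * q x) \<le>
        (1 + t) * (p x + g x - 2 * sqrt (p x * g x)) + (1 + 1 / t) * (p x + q x - 2 * sqrt (p x * q x))"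
      unfolding sq[OF nn(1) nn(2)] sq[OF nn(2) nn(3)] sq[OF nn(1) nn(3)]
      by (rule sqrt_diff_weak_triangle[OF t])
  qed (use i s in auto)
  also have "\<dots> = (1 + t) * (2 * hell \<mu> p g) + (1 + 1 / t) * (2 * hell \<mu> p q)"
    using i s one by (simp add: hell_def)
  also have "(\<integral>x. g x + q x - 2 * sqrt (g x * q x) \<partial>\<mu>) = 2 * hell \<mu> g q"
    using i s one by (simp add: hell_def)
  finally show ?thesis by simp
qed

text \<open>The bound \<open>\<gamma>\<close> must not depend on the densities, because the same decay rate has to serve for
all sets of the cover and for all posteriors on them.\<close>

lemma hell_separation:
  fixes \<delta> \<epsilon> :: real
  assumes de: "0 < \<delta>" "\<delta> < \<epsilon>"
  obtains \<gamma> where "0 < \<gamma>" and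
    "\<And>(\<mu> :: 'a measure) p g q. \<lbrakk>unit_density \<mu> p; unit_density \<mu> g; unit_density \<mu> q; hell \<mu> p g \<le> \<delta>; \<epsilon> < hell \<mu> g q\<rbrakk>
      \<Longrightarrow> \<gamma> \<le> hell \<mu> p q"
proof
  \<comment> \<open>This \<open>t\<close> puts \<open>(1 + t) * \<delta>\<close> halfway between \<open>\<delta>\<close> and \<open>\<epsilon>\<close>.\<close>
  define t where "t = (\<epsilon> - \<delta>) / (2 * \<delta>)"
  have t: "0 < t" "(1 + t) * \<delta> = (\<epsilon> + \<delta>) / 2"
    using de by (auto simp: t_def field_simps)
  define \<gamma> where "\<gamma> = (\<epsilon> - \<delta>) / 2 / (1 + 1 / t)"
  show "0 < \<gamma>" using t de by (auto simp: \<gamma>_def add_pos_pos)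
  fix \<mu> :: "'a measure" and p g q
  assume d: "unit_density \<mu> p" "unit_density \<mu> g" "unit_density \<mu> q"
    and h: "hell \<mu> p g \<le> \<delta>" "\<epsilon> < hell \<mu> g q"
  have le: "(1 + t) * hell \<mu> p g \<le> (1 + t) * \<delta>"
    using h t by (intro mult_left_mono) auto
  have "b \<ge> (\<epsilon> - \<delta>) / 2" if "\<epsilon> < hell \<mu> g q" "hell \<mu> g q \<le> a + b" "a \<le> (\<epsilon> + \<delta>) / 2" for a b
    using that by (simp add: field_simps)
  from this[OF h(2) hell_weak_triangle[OF d t(1)] le[unfolded t(2)]]
  have "(\<epsilon> - \<delta>) / 2 \<le> (1 + 1 / t) * hell \<mu> p q" .
  moreover have "0 < 1 + 1 / t" using t by (simp add: add_pos_pos)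
  ultimately show "\<gamma> \<le> hell \<mu> p q"
    unfolding \<gamma>_def by (subst pos_divide_le_eq) (simp_all add: mult.commute)
qed

section \<open>Mixtures of densities near a given one\<close>

text \<open>Total mass \<open>1\<close> is not required: the class has to be closed under restricting to a set of
densities and under reweighting by the likelihood ratio of an observation.\<close>

definition mixing :: "'a measure \<Rightarrow> ('a \<Rightarrow> real) measure \<Rightarrow> bool" where
  "mixing \<mu> Q \<longleftrightarrow> finite_measure Q \<and> space Q \<subseteq> prob_densities \<mu> \<and>
    (\<lambda>(f, x). f x) \<in> borel_measurable (Q \<Otimes>\<^sub>M \<mu>)"

text \<open>Real-valued, with value \<open>0\<close> at the points where the mixture is infinite; these form a null set
by \<open>AE_mixture\<close> below.\<close>

definition mixture :: "('a \<Rightarrow> real) measure \<Rightarrow> 'a \<Rightarrow> real" where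
  "mixture Q x = enn2real (\<integral>\<^sup>+f. ennreal (f x) \<partial>Q)"

lemma mixture_nonneg [simp]: "0 \<le> mixture Q x"
  by (simp add: mixture_def)

lemma le_ennreal_sqrt:
  assumes "I\<^sup>2 \<le> ennreal a" "0 \<le> a" shows "I \<le> ennreal (sqrt a)"
proof (cases I)
  case (real r)
  then have "r\<^sup>2 \<le> a" using assms by (simp add: ennreal_power)
  then show ?thesis unfolding real by (intro ennreal_leI real_le_rsqrt)
next
  case top
  then show ?thesis using assms by (simp add: ennreal_top_eq_mult_iff power2_eq_square ennreal_mult_top top_unique)
qed

context
  fixes \<mu> :: "'a measure" and Q :: "('a \<Rightarrow> real) measure"
  assumes \<mu>: "sigma_finite_measure \<mu>" and Q: "mixing \<mu> Q"
begin

interpretation mu: sigma_finite_measure \<mu> by (rule \<mu>)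
interpretation Q: finite_measure Q using Q by (simp add: mixing_def)
interpretation pair_sigma_finite Q \<mu> ..

lemma eval_measurable [measurable]: "(\<lambda>p. fst p (snd p)) \<in> borel_measurable (Q \<Otimes>\<^sub>M \<mu>)"
  using Q by (simp add: mixing_def split_beta')

lemma eval_measurable_fst [measurable]:
  assumes "x \<in> space \<mu>" shows "(\<lambda>f. f x) \<in> borel_measurable Q"
proof -
  have "(\<lambda>f. (f, x)) \<in> Q \<rightarrow>\<^sub>M Q \<Otimes>\<^sub>M \<mu>" using assms by simp
  from measurable_compose[OF this eval_measurable] show ?thesis by simp
qed

lemma mixing_unit_density: "f \<in> space Q \<Longrightarrow> unit_density \<mu> f"
  using Q unit_density_prob_densities by (auto simp: mixing_def)

lemma mixing_nonneg: "f \<in> space Q \<Longrightarrow> x \<in> space \<mu> \<Longrightarrow> 0 \<le> f x"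
  using mixing_unit_density by (auto simp: unit_density_def)

lemma nn_integral_density_eq_1: "f \<in> space Q \<Longrightarrow> (\<integral>\<^sup>+x. ennreal (f x) \<partial>\<mu>) = 1"
  using Q by (auto simp: mixing_def prob_densities_def)

lemma eval_swap_measurable [measurable]: "(\<lambda>p. snd p (fst p)) \<in> borel_measurable (\<mu> \<Otimes>\<^sub>M Q)"
  using measurable_compose[OF measurable_pair_swap' eval_measurable] by (simp add: split_beta')

lemma nn_mixture_measurable [measurable]: "(\<lambda>x. \<integral>\<^sup>+f. ennreal (f x) \<partial>Q) \<in> borel_measurable \<mu>"
proof -
  have "(\<lambda>(x, f). ennreal (f x)) \<in> borel_measurable (\<mu> \<Otimes>\<^sub>M Q)"
    by (simp add: split_beta')
  then show ?thesis by (rule Q.borel_measurable_nn_integral)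
qed

lemma mixture_measurable [measurable]: "mixture Q \<in> borel_measurable \<mu>"
  unfolding mixture_def[abs_def] by measurable

lemma nn_integral_nn_mixture:
  "(\<integral>\<^sup>+x. \<integral>\<^sup>+f. ennreal (f x) \<partial>Q \<partial>\<mu>) = emeasure Q (space Q)"
proof -
  have "(\<integral>\<^sup>+x. \<integral>\<^sup>+f. ennreal (f x) \<partial>Q \<partial>\<mu>) = (\<integral>\<^sup>+f. \<integral>\<^sup>+x. ennreal (f x) \<partial>\<mu> \<partial>Q)"
    using Fubini[of "\<lambda>p. ennreal (fst p (snd p))"] by simp
  also have "\<dots> = (\<integral>\<^sup>+f. 1 \<partial>Q)"
    by (intro nn_integral_cong) (rule nn_integral_density_eq_1)
  finally show ?thesis by simp
qed

lemma AE_mixture: "AE x in \<mu>. (\<integral>\<^sup>+f. ennreal (f x) \<partial>Q) = ennreal (mixture Q x)"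
proof -
  have "AE x in \<mu>. (\<integral>\<^sup>+f. ennreal (f x) \<partial>Q) \<noteq> \<infinity>"
    by (rule nn_integral_noteq_infinite) (auto simp: nn_integral_nn_mixture)
  then show ?thesis
    by eventually_elim (simp add: mixture_def less_top)
qed

lemma unit_density_mixture:
  assumes m: "measure Q (space Q) = m" "0 < m"
  shows "unit_density \<mu> (\<lambda>x. mixture Q x / m)"
proof (rule unit_densityI)
  have "(\<integral>\<^sup>+x. ennreal (mixture Q x / m) \<partial>\<mu>) = (\<integral>\<^sup>+x. ennreal (1 / m) * ennreal (mixture Q x) \<partial>\<mu>)"
    using m by (intro nn_integral_cong) (simp add: ennreal_mult[symmetric])
  also have "\<dots> = ennreal (1 / m) * (\<integral>\<^sup>+x. ennreal (mixture Q x) \<partial>\<mu>)"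
    by (rule nn_integral_cmult) measurable
  also have "(\<integral>\<^sup>+x. ennreal (mixture Q x) \<partial>\<mu>) = (\<integral>\<^sup>+x. \<integral>\<^sup>+f. ennreal (f x) \<partial>Q \<partial>\<mu>)"
    using AE_mixture by (intro nn_integral_cong_AE) auto
  also have "\<dots> = ennreal m"
    using m by (simp add: nn_integral_nn_mixture Q.emeasure_eq_measure)
  also have "ennreal (1 / m) * ennreal m = 1"
    using m by (simp add: ennreal_mult[symmetric])
  finally show "(\<integral>\<^sup>+x. ennreal (mixture Q x / m) \<partial>\<mu>) = 1" .
qed (use m in auto)

text \<open>The Cauchy--Schwarz inequality for $\sqrt{f(x)} \cdot 1$.  This is the concavity of the square root
in the form that also covers unnormalized \<open>Q\<close>.\<close>

lemma nn_integral_sqrt_le_mixture: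
  assumes x: "x \<in> space \<mu>" and fin: "(\<integral>\<^sup>+f. ennreal (f x) \<partial>Q) = ennreal (mixture Q x)"
  shows "(\<integral>\<^sup>+f. ennreal (sqrt (f x)) \<partial>Q) \<le> ennreal (sqrt (mixture Q x * measure Q (space Q)))"
proof (rule le_ennreal_sqrt)
  note [measurable] = eval_measurable_fst[OF x]
  have "(\<integral>\<^sup>+f. ennreal (sqrt (f x)) * 1 \<partial>Q)\<^sup>2 \<le> (\<integral>\<^sup>+f. (ennreal (sqrt (f x)))\<^sup>2 \<partial>Q) * (\<integral>\<^sup>+f. 1\<^sup>2 \<partial>Q)"
    by (rule Cauchy_Schwarz_nn_integral) auto
  also have "(\<integral>\<^sup>+f. (ennreal (sqrt (f x)))\<^sup>2 \<partial>Q) = (\<integral>\<^sup>+f. ennreal (f x) \<partial>Q)"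
    using x by (intro nn_integral_cong) (simp add: ennreal_power mixing_nonneg)
  finally show "(\<integral>\<^sup>+f. ennreal (sqrt (f x)) \<partial>Q)\<^sup>2 \<le> ennreal (mixture Q x * measure Q (space Q))"
    using fin by (simp add: Q.emeasure_eq_measure ennreal_mult)
qed simp

text \<open>Hellinger balls are convex: the affinity with \<open>g\<close> is concave, so that the affinity of the mixture
is at least the average of the affinities, which are all at least \<open>1 - \<delta>\<close>.\<close>

lemma hell_mixture_le:
  assumes m: "measure Q (space Q) = m" "0 < m"
    and g: "unit_density \<mu> g"
    and near: "AE f in Q. hell \<mu> f g \<le> \<delta>"
  shows "hell \<mu> (\<lambda>x. mixture Q x / m) g \<le> \<delta>"
proof -
  have [measurable]: "g \<in> borel_measurable \<mu>" using g by (auto simp: unit_density_def)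
  have gnn: "0 \<le> g x" if "x \<in> space \<mu>" for x using g that by (auto simp: unit_density_def)
  let ?s = "\<lambda>x. sqrt (mixture Q x / m * g x)"
  have ints: "integrable \<mu> ?s"
    by (rule integrable_sqrt_mult[OF unit_density_mixture[OF m] g])
  have "ennreal ((1 - \<delta>) * m) = (\<integral>\<^sup>+f. ennreal (1 - \<delta>) \<partial>Q)"
    using m by (simp add: Q.emeasure_eq_measure ennreal_mult'')
  also have "\<dots> \<le> (\<integral>\<^sup>+f. \<integral>\<^sup>+x. ennreal (sqrt (f x)) * ennreal (sqrt (g x)) \<partial>\<mu> \<partial>Q)"
  proof (rule nn_integral_mono_AE)
    show "AE f in Q. ennreal (1 - \<delta>) \<le> (\<integral>\<^sup>+x. ennreal (sqrt (f x)) * ennreal (sqrt (g x)) \<partial>\<mu>)"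
      using near AE_space
    proof eventually_elim
      case (elim f)
      note f = mixing_unit_density[OF elim(2)]
      have "(\<integral>\<^sup>+x. ennreal (sqrt (f x)) * ennreal (sqrt (g x)) \<partial>\<mu>) = (\<integral>\<^sup>+x. ennreal (sqrt (f x * g x)) \<partial>\<mu>)"
        using elim(2) gnn
        by (intro nn_integral_cong) (simp add: ennreal_mult[symmetric] real_sqrt_mult mixing_nonneg)
      also have "\<dots> = ennreal (\<integral>x. sqrt (f x * g x) \<partial>\<mu>)"
        using elim(2) gnn by (intro nn_integral_eq_integral integrable_sqrt_mult f g AE_I2) (simp add: mixing_nonneg)
      finally show ?case using elim(1) by (simp add: hell_def ennreal_leI)
    qed
  qed
  also have "\<dots> = (\<integral>\<^sup>+x. \<integral>\<^sup>+f. ennreal (sqrt (f x)) * ennreal (sqrt (g x)) \<partial>Q \<partial>\<mu>)"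
    using Fubini[of "\<lambda>p. ennreal (sqrt (fst p (snd p))) * ennreal (sqrt (g (snd p)))"] by simp
  also have "\<dots> \<le> (\<integral>\<^sup>+x. ennreal m * ennreal (?s x) \<partial>\<mu>)"
  proof (rule nn_integral_mono_AE)
    show "AE x in \<mu>. (\<integral>\<^sup>+f. ennreal (sqrt (f x)) * ennreal (sqrt (g x)) \<partial>Q) \<le> ennreal m * ennreal (?s x)"
      using AE_mixture AE_space
    proof eventually_elim
      case (elim x)
      note [measurable] = eval_measurable_fst[OF elim(2)]
      have "(\<integral>\<^sup>+f. ennreal (sqrt (f x)) * ennreal (sqrt (g x)) \<partial>Q)
          = (\<integral>\<^sup>+f. ennreal (sqrt (f x)) \<partial>Q) * ennreal (sqrt (g x))"
        by (rule nn_integral_multc) measurable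
      also have "\<dots> \<le> ennreal (sqrt (mixture Q x * m)) * ennreal (sqrt (g x))"
        using nn_integral_sqrt_le_mixture[OF elim(2,1)] m by (intro mult_right_mono) auto
      also have "\<dots> = ennreal m * ennreal (?s x)"
      proof -
        have "sqrt m * sqrt m = m" using m by simp
        then have "sqrt (mixture Q x * m) * sqrt (g x) = m * ?s x"
          using m by (simp add: real_sqrt_mult real_sqrt_divide field_simps)
        then show ?thesis
          using m gnn[OF elim(2)] by (simp add: ennreal_mult[symmetric])
      qed
      finally show ?case .
    qed
  qed
  also have "\<dots> = ennreal m * (\<integral>\<^sup>+x. ennreal (?s x) \<partial>\<mu>)"
    by (rule nn_integral_cmult) measurable
  also have "(\<integral>\<^sup>+x. ennreal (?s x) \<partial>\<mu>) = ennreal (\<integral>x. ?s x \<partial>\<mu>)"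
    using m gnn by (intro nn_integral_eq_integral ints AE_I2) simp
  finally have le: "ennreal ((1 - \<delta>) * m) \<le> ennreal (m * (\<integral>x. ?s x \<partial>\<mu>))"
    using m by (simp add: ennreal_mult')
  have "0 \<le> (\<integral>x. ?s x \<partial>\<mu>)"
    using m gnn by (intro integral_nonneg_AE AE_I2) simp
  then have "(1 - \<delta>) * m \<le> m * (\<integral>x. ?s x \<partial>\<mu>)"
    using le m by (subst (asm) ennreal_le_iff) auto
  then show ?thesis using m by (simp add: hell_def mult.commute)
qed

lemma nn_integral_ratio:
  assumes x: "x \<in> space \<mu>" and nn: "0 \<le> y"
    and fin: "(\<integral>\<^sup>+f. ennreal (f x) \<partial>Q) = ennreal (mixture Q x)"
  shows "(\<integral>\<^sup>+f. ennreal (f x / y) \<partial>Q) = ennreal (mixture Q x / y)"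
proof -
  note [measurable] = eval_measurable_fst[OF x]
  have "(\<integral>\<^sup>+f. ennreal (f x / y) \<partial>Q) = (\<integral>\<^sup>+f. ennreal (f x) * ennreal (1 / y) \<partial>Q)"
    using x nn by (intro nn_integral_cong) (simp add: ennreal_mult[symmetric] mixing_nonneg)
  also have "\<dots> = ennreal (mixture Q x) * ennreal (1 / y)"
    by (subst nn_integral_multc) (auto simp: fin)
  finally show ?thesis using nn by (simp add: ennreal_mult[symmetric])
qed

text \<open>One observation multiplies the root of the integrated likelihood, on average, by the affinity between
\<open>f0\<close> and the normalized mixture (the predictive density).\<close>

lemma affinity_mixture_le:
  assumes f0: "f0 \<in> prob_densities \<mu>"
    and far: "0 < measure Q (space Q) \<Longrightarrow> \<gamma> \<le> hell \<mu> (\<lambda>x. mixture Q x / measure Q (space Q)) f0"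
  shows "(\<integral>\<^sup>+x. ennreal (sqrt (enn2real (\<integral>\<^sup>+f. ennreal (f x / f0 x) \<partial>Q))) \<partial>density \<mu> (\<lambda>x. ennreal (f0 x)))
    \<le> ennreal ((1 - \<gamma>) * sqrt (measure Q (space Q)))"
proof -
  define m where "m = measure Q (space Q)"
  note ud0 = unit_density_prob_densities[OF f0]
  have [measurable]: "f0 \<in> borel_measurable \<mu>" using ud0 by (auto simp: unit_density_def)
  have nn0: "0 \<le> f0 x" if "x \<in> space \<mu>" for x using ud0 that by (auto simp: unit_density_def)
  show ?thesis
  proof (cases "m = 0")
    case True
    then have "AE f in Q. False"
      by (intro AE_I[where N = "space Q"]) (auto simp: Q.emeasure_eq_measure m_def)
    then have z: "(\<integral>\<^sup>+f. F f \<partial>Q) = 0" for F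
    proof -
      have "AE f in Q. F f = 0" using \<open>AE f in Q. False\<close> by (rule eventually_mono) simp
      then show ?thesis by (simp cong: nn_integral_cong_AE)
    qed
    show ?thesis by (simp add: z)
  next
    case False
    then have m: "0 < m" by (simp add: m_def zero_less_measure_iff less_le)
    let ?s = "\<lambda>x. sqrt (mixture Q x / m * f0 x)"
    have ud: "unit_density \<mu> (\<lambda>x. mixture Q x / m)"
      by (rule unit_density_mixture[OF m_def[symmetric] m])
    have [measurable]: "(\<lambda>x. \<integral>\<^sup>+f. ennreal (f x / f0 x) \<partial>Q) \<in> borel_measurable \<mu>"
    proof -
      have "(\<lambda>(x, f). ennreal (f x / f0 x)) \<in> borel_measurable (\<mu> \<Otimes>\<^sub>M Q)"
        by (simp add: split_beta')
      then show ?thesis by (rule Q.borel_measurable_nn_integral)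
    qed
    have "(\<integral>\<^sup>+x. ennreal (sqrt (enn2real (\<integral>\<^sup>+f. ennreal (f x / f0 x) \<partial>Q))) \<partial>density \<mu> (\<lambda>x. ennreal (f0 x)))
        = (\<integral>\<^sup>+x. ennreal (f0 x) * ennreal (sqrt (enn2real (\<integral>\<^sup>+f. ennreal (f x / f0 x) \<partial>Q))) \<partial>\<mu>)"
      by (rule nn_integral_density) measurable
    also have "\<dots> = (\<integral>\<^sup>+x. ennreal (sqrt m) * ennreal (?s x) \<partial>\<mu>)"
    proof (rule nn_integral_cong_AE)
      show "AE x in \<mu>. ennreal (f0 x) * ennreal (sqrt (enn2real (\<integral>\<^sup>+f. ennreal (f x / f0 x) \<partial>Q)))
          = ennreal (sqrt m) * ennreal (?s x)"
        using AE_mixture AE_space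
      proof eventually_elim
        case (elim x)
        have "sqrt (f0 x) * sqrt (f0 x) = f0 x" using nn0[OF elim(2)] by simp
        \<comment> \<open>Where \<open>f0 x = 0\<close>, both sides vanish, since division by \<open>0\<close> yields \<open>0\<close>.\<close>
        then have "f0 x * sqrt (mixture Q x / f0 x) = sqrt m * ?s x"
          using m by (cases "f0 x = 0") (simp_all add: real_sqrt_mult real_sqrt_divide field_simps)
        then show ?case
          using m nn0[OF elim(2)] by (simp add: nn_integral_ratio[OF elim(2) nn0[OF elim(2)] elim(1)] ennreal_mult[symmetric])
      qed
    qed
    also have "\<dots> = ennreal (sqrt m) * (\<integral>\<^sup>+x. ennreal (?s x) \<partial>\<mu>)"
      by (rule nn_integral_cmult) measurable
    also have "(\<integral>\<^sup>+x. ennreal (?s x) \<partial>\<mu>) = ennreal (\<integral>x. ?s x \<partial>\<mu>)"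
      using m nn0 by (intro nn_integral_eq_integral integrable_sqrt_mult ud ud0 AE_I2) simp
    also have "\<dots> = ennreal (1 - hell \<mu> (\<lambda>x. mixture Q x / m) f0)"
      by (simp add: hell_def)
    finally have "(\<integral>\<^sup>+x. ennreal (sqrt (enn2real (\<integral>\<^sup>+f. ennreal (f x / f0 x) \<partial>Q))) \<partial>density \<mu> (\<lambda>x. ennreal (f0 x)))
        = ennreal (sqrt m) * ennreal (1 - hell \<mu> (\<lambda>x. mixture Q x / m) f0)" .
    also have "\<dots> \<le> ennreal (sqrt m) * ennreal (1 - \<gamma>)"
      using far m by (intro mult_left_mono ennreal_leI) (simp_all add: m_def)
    also have "\<dots> = ennreal ((1 - \<gamma>) * sqrt m)"
      using m by (simp add: ennreal_mult'[symmetric] mult.commute)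
    finally show ?thesis by (simp only: m_def)
  qed
qed

end

section \<open>Exponential decay of the integrated likelihood\<close>

text \<open>The value at \<open>\<infinity>\<close> is \<open>\<infinity>\<close>, so that squaring recovers the argument everywhere.\<close>

definition ennsqrt :: "ennreal \<Rightarrow> ennreal" where
  "ennsqrt x = (if x = \<infinity> then \<infinity> else ennreal (sqrt (enn2real x)))"

lemma ennsqrt_measurable [measurable]: "ennsqrt \<in> borel_measurable borel"
  unfolding ennsqrt_def[abs_def] by measurable

lemma ennsqrt_power2: "(ennsqrt x)\<^sup>2 = x"
  by (cases x) (auto simp: ennsqrt_def ennreal_power power2_eq_square[of top])

lemma lik_ratio_0 [simp]: "lik_ratio f0 0 \<omega> f = 1"
  by (simp add: lik_ratio_def)

lemma lik_ratio_Suc: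
  "lik_ratio f0 (Suc n) (case_nat x \<omega>) f = f x / f0 x * lik_ratio f0 n \<omega> f"
  unfolding lik_ratio_def by (simp add: prod.lessThan_Suc_shift del: prod.lessThan_Suc)

text \<open>The measure \<open>D\<close> below is the law of one observation, and \<open>seq.S\<close> is the law of the whole
sequence of observations.\<close>

locale iid_model = mu: sigma_finite_measure \<mu> for \<mu> :: "'a measure" +
  fixes f0 :: "'a \<Rightarrow> real"
  assumes f0: "f0 \<in> prob_densities \<mu>"
begin

definition D :: "'a measure" where "D = density \<mu> (\<lambda>x. ennreal (f0 x))"

lemma f0_measurable [measurable]: "f0 \<in> borel_measurable \<mu>"
  using f0 by (simp add: prob_densities_def)

lemma f0_nonneg: "x \<in> space \<mu> \<Longrightarrow> 0 \<le> f0 x"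
  using f0 by (auto simp: prob_densities_def PiE_iff)

lemma sets_D [measurable_cong]: "sets D = sets \<mu>" by (simp add: D_def)

lemma space_D: "space D = space \<mu>" by (simp add: D_def)

lemma prob_space_D: "prob_space D"
proof
  show "emeasure D (space D) = 1"
    using f0 by (simp add: D_def emeasure_density prob_densities_def cong: nn_integral_cong)
qed

sublocale D: prob_space D by (rule prob_space_D)
sublocale seq: sequence_space D by unfold_locales

lemma lik_ratio_measurable:
  assumes "mixing \<mu> Q"
  shows "(\<lambda>(\<omega>, f). lik_ratio f0 n \<omega> f) \<in> borel_measurable (seq.S \<Otimes>\<^sub>M Q)"
proof -
  have e: "(\<lambda>(f, x). f x) \<in> borel_measurable (Q \<Otimes>\<^sub>M \<mu>)"
    using assms by (simp add: mixing_def)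
  have c: "(\<lambda>p. fst p i) \<in> seq.S \<Otimes>\<^sub>M Q \<rightarrow>\<^sub>M \<mu>" for i
  proof -
    have "(\<lambda>\<omega>. \<omega> i) \<in> seq.S \<rightarrow>\<^sub>M \<mu>"
      using measurable_component_singleton[of i UNIV "\<lambda>_. D"] by (simp cong: measurable_cong_sets add: sets_D)
    then show ?thesis by (rule measurable_compose[OF measurable_fst])
  qed
  have "(\<lambda>p. (snd p, fst p i)) \<in> seq.S \<Otimes>\<^sub>M Q \<rightarrow>\<^sub>M Q \<Otimes>\<^sub>M \<mu>" for i
    using c by (intro measurable_Pair) auto
  from measurable_compose[OF this e]
  have [measurable]: "(\<lambda>p. (snd p) (fst p i)) \<in> borel_measurable (seq.S \<Otimes>\<^sub>M Q)" for i
    by simp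
  have [measurable]: "(\<lambda>p. f0 (fst p i)) \<in> borel_measurable (seq.S \<Otimes>\<^sub>M Q)" for i
    by (rule measurable_compose[OF c f0_measurable])
  show ?thesis unfolding lik_ratio_def split_beta' by measurable
qed

lemma lik_ratio_measurable_snd:
  assumes Q: "mixing \<mu> Q" and \<omega>: "\<omega> \<in> space seq.S"
  shows "(\<lambda>f. lik_ratio f0 n \<omega> f) \<in> borel_measurable Q"
  using measurable_compose[OF measurable_Pair1'[OF \<omega>] lik_ratio_measurable[OF Q]] by simp

lemma marginal_measurable:
  assumes Q: "mixing \<mu> Q"
  shows "(\<lambda>\<omega>. \<integral>\<^sup>+f. ennreal (lik_ratio f0 n \<omega> f) \<partial>Q) \<in> borel_measurable seq.S"
proof -
  interpret finite_measure Q using Q by (simp add: mixing_def)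
  have "(\<lambda>(\<omega>, f). ennreal (lik_ratio f0 n \<omega> f)) \<in> borel_measurable (seq.S \<Otimes>\<^sub>M Q)"
    using measurable_compose[OF lik_ratio_measurable[OF Q] measurable_ennreal] by (simp add: split_beta')
  then show ?thesis by (rule borel_measurable_nn_integral)
qed

lemma mixing_density:
  assumes Q: "mixing \<mu> Q" and w: "w \<in> borel_measurable Q" and fin: "(\<integral>\<^sup>+f. w f \<partial>Q) \<noteq> \<infinity>"
  shows "mixing \<mu> (density Q w)"
proof -
  have "finite_measure (density Q w)"
    using fin w by (intro finite_measureI) (simp add: emeasure_density cong: nn_integral_cong)
  moreover
  have "borel_measurable (density Q w \<Otimes>\<^sub>M \<mu>) = (borel_measurable (Q \<Otimes>\<^sub>M \<mu>) :: (_ \<Rightarrow> real) set)"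
    by (intro measurable_cong_sets sets_pair_measure_cong) simp_all
  then have "(\<lambda>(f, x). f x) \<in> borel_measurable (density Q w \<Otimes>\<^sub>M \<mu>)"
    using Q by (simp only: mixing_def)
  ultimately show ?thesis using Q by (simp add: mixing_def)
qed

text \<open>Induction over the sample size, for all finite measures \<open>Q\<close> near \<open>g\<close> at once.  Given the first
observation \<open>x\<close>, the induction hypothesis applies to \<open>Q\<close> reweighted by $f(x)/f_0(x)$, which is
again concentrated near \<open>g\<close>.  The root of its mass is then integrated over \<open>x\<close> by
\<open>affinity_mixture_le\<close>.\<close>

lemma expectation_sqrt_marginal_le:
  assumes Q: "mixing \<mu> Q" and g: "unit_density \<mu> g" and near: "AE f in Q. hell \<mu> f g \<le> \<delta>"
    and sep: "\<And>p. unit_density \<mu> p \<Longrightarrow> hell \<mu> p g \<le> \<delta> \<Longrightarrow> \<gamma> \<le> hell \<mu> p f0"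
    and \<gamma>: "\<gamma> \<le> 1"
  shows "(\<integral>\<^sup>+\<omega>. ennsqrt (\<integral>\<^sup>+f. ennreal (lik_ratio f0 n \<omega> f) \<partial>Q) \<partial>seq.S)
    \<le> ennreal ((1 - \<gamma>) ^ n * sqrt (measure Q (space Q)))"
  using Q near
proof (induction n arbitrary: Q)
  case 0
  interpret finite_measure Q using 0 by (simp add: mixing_def)
  show ?case by (simp add: ennsqrt_def emeasure_eq_measure seq.P.emeasure_space_1)
next
  case (Suc n)
  note Q = Suc.prems(1)
  note meas = marginal_measurable[OF Q]
  note sf = mu.sigma_finite_measure_axioms
  define Qx where "Qx x = density Q (\<lambda>f. ennreal (f x / f0 x))" for x
  define r where "r x = (\<integral>\<^sup>+f. ennreal (f x / f0 x) \<partial>Q)" for x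
  have "(\<integral>\<^sup>+\<omega>. ennsqrt (\<integral>\<^sup>+f. ennreal (lik_ratio f0 (Suc n) \<omega> f) \<partial>Q) \<partial>seq.S)
      = (\<integral>\<^sup>+x. \<integral>\<^sup>+\<omega>. ennsqrt (\<integral>\<^sup>+f. ennreal (lik_ratio f0 (Suc n) (case_nat x \<omega>) f) \<partial>Q) \<partial>seq.S \<partial>D)"
    by (rule seq.nn_integral_uncons) (rule measurable_compose[OF meas ennsqrt_measurable])
  also have "\<dots> \<le> (\<integral>\<^sup>+x. ennreal ((1 - \<gamma>) ^ n) * ennreal (sqrt (enn2real (r x))) \<partial>D)"
  proof (rule nn_integral_mono_AE)
    have "AE x in D. (\<integral>\<^sup>+f. ennreal (f x) \<partial>Q) = ennreal (mixture Q x)"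
      unfolding D_def using AE_mixture[OF sf Q] by (subst AE_density) auto
    with AE_space show "AE x in D. (\<integral>\<^sup>+\<omega>. ennsqrt (\<integral>\<^sup>+f. ennreal (lik_ratio f0 (Suc n) (case_nat x \<omega>) f) \<partial>Q) \<partial>seq.S)
        \<le> ennreal ((1 - \<gamma>) ^ n) * ennreal (sqrt (enn2real (r x)))"
    proof eventually_elim
      case (elim x)
      then have x: "x \<in> space \<mu>" by (simp add: space_D)
      note [measurable] = eval_measurable_fst[OF sf Q x]
      have w: "(\<lambda>f. ennreal (f x / f0 x)) \<in> borel_measurable Q" by measurable
      \<comment> \<open>Finite total mass, which the induction hypothesis requires, holds for almost every \<open>x\<close> only.\<close>
      have rfin: "r x \<noteq> \<infinity>"
        unfolding r_def by (subst nn_integral_ratio[OF sf Q x f0_nonneg[OF x] elim(2)]) simp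
      have mix: "mixing \<mu> (Qx x)"
        unfolding Qx_def using rfin by (intro mixing_density Q w) (simp add: r_def)
      have near': "AE f in Qx x. hell \<mu> f g \<le> \<delta>"
        unfolding Qx_def using Suc.prems(2) by (subst AE_density[OF w]) auto
      have mass: "measure (Qx x) (space (Qx x)) = enn2real (r x)"
        by (simp add: measure_def Qx_def emeasure_density w r_def cong: nn_integral_cong)
      have "(\<integral>\<^sup>+\<omega>. ennsqrt (\<integral>\<^sup>+f. ennreal (lik_ratio f0 (Suc n) (case_nat x \<omega>) f) \<partial>Q) \<partial>seq.S)
          = (\<integral>\<^sup>+\<omega>. ennsqrt (\<integral>\<^sup>+f. ennreal (lik_ratio f0 n \<omega> f) \<partial>Qx x) \<partial>seq.S)"
      proof (intro nn_integral_cong arg_cong[where f = ennsqrt])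
        fix \<omega> assume \<omega>: "\<omega> \<in> space seq.S"
        have m: "(\<lambda>f. ennreal (lik_ratio f0 n \<omega> f)) \<in> borel_measurable Q"
          using lik_ratio_measurable_snd[OF Q \<omega>] by measurable
        show "(\<integral>\<^sup>+f. ennreal (lik_ratio f0 (Suc n) (case_nat x \<omega>) f) \<partial>Q) = (\<integral>\<^sup>+f. ennreal (lik_ratio f0 n \<omega> f) \<partial>Qx x)"
          unfolding Qx_def nn_integral_density[OF w m] lik_ratio_Suc
          using mixing_nonneg[OF sf Q _ x] f0_nonneg[OF x]
          by (intro nn_integral_cong) (subst ennreal_mult'[symmetric], auto)
      qed
      also have "\<dots> \<le> ennreal ((1 - \<gamma>) ^ n * sqrt (enn2real (r x)))"
        using Suc.IH[OF mix near'] by (simp add: mass)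
      finally show ?case using \<gamma> by (simp add: ennreal_mult)
    qed
  qed
  also have "\<dots> = ennreal ((1 - \<gamma>) ^ n) * (\<integral>\<^sup>+x. ennreal (sqrt (enn2real (r x))) \<partial>D)"
  proof (rule nn_integral_cmult)
    interpret finite_measure Q using Q by (simp add: mixing_def)
    note [measurable] = eval_swap_measurable[OF sf Q]
    have "(\<lambda>(x, f). ennreal (f x / f0 x)) \<in> borel_measurable (\<mu> \<Otimes>\<^sub>M Q)"
      by (simp add: split_beta')
    then have [measurable]: "r \<in> borel_measurable \<mu>"
      unfolding r_def[abs_def] by (rule borel_measurable_nn_integral)
    show "(\<lambda>x. ennreal (sqrt (enn2real (r x)))) \<in> borel_measurable D" by measurable
  qed
  also have "\<dots> \<le> ennreal ((1 - \<gamma>) ^ n) * ennreal ((1 - \<gamma>) * sqrt (measure Q (space Q)))"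
  proof (rule mult_left_mono)
    show "(\<integral>\<^sup>+x. ennreal (sqrt (enn2real (r x))) \<partial>D) \<le> ennreal ((1 - \<gamma>) * sqrt (measure Q (space Q)))"
      unfolding D_def r_def
    proof (rule affinity_mixture_le[OF sf Q f0])
      assume "0 < measure Q (space Q)"
      then show "\<gamma> \<le> hell \<mu> (\<lambda>x. mixture Q x / measure Q (space Q)) f0"
        by (intro sep unit_density_mixture[OF sf Q refl] hell_mixture_le[OF sf Q refl _ g Suc.prems(2)])
    qed
  qed simp
  also have "\<dots> = ennreal ((1 - \<gamma>) ^ Suc n * sqrt (measure Q (space Q)))"
    using \<gamma> by (simp add: ennreal_mult[symmetric] mult.assoc mult.left_commute)
  finally show ?case .
qed

end

section \<open>Lower bound for the marginal likelihood\<close>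

context iid_model
begin

lemma AE_D_I:
  assumes "AE x in \<mu>. 0 < f0 x \<longrightarrow> P x" shows "AE x in D. P x"
  unfolding D_def using assms by (subst AE_density) auto

lemma f0_pos_AE: "AE x in D. 0 < f0 x"
  by (rule AE_D_I) simp

text \<open>A finite divergence forces \<open>f\<close> to be positive where \<open>f0\<close> is, and the negative part of the
integrand is integrable because $f_0 \ln(f/f_0) \le f - f_0$.  So the extended integral that defines
the divergence is an ordinary expectation under \<open>f0\<close>.\<close>

lemma kl_div_less_imp:
  assumes f: "f \<in> prob_densities \<mu>" and kl: "kl_div \<mu> f f0 < ereal \<eta>"
  shows "AE x in D. 0 < f x"
    and "integrable D (\<lambda>x. ln (f0 x / f x))"
    and "(\<integral>x. ln (f0 x / f x) \<partial>D) < \<eta>"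
proof -
  have [measurable]: "f \<in> borel_measurable \<mu>" using f by (simp add: prob_densities_def)
  have f_nonneg: "0 \<le> f x" if "x \<in> space \<mu>" for x
    using f that by (auto simp: prob_densities_def PiE_iff)
  define r where "r x = f0 x * ln (f0 x / f x)" for x
  have r[measurable]: "r \<in> borel_measurable \<mu>" unfolding r_def[abs_def] by measurable
  let ?P = "\<integral>\<^sup>+x. e2ennreal (kl_integrand f f0 x) \<partial>\<mu>"
  let ?N = "\<integral>\<^sup>+x. e2ennreal (- kl_integrand f f0 x) \<partial>\<mu>"
  have k[measurable]: "kl_integrand f f0 \<in> borel_measurable \<mu>"
    unfolding kl_integrand_def[abs_def] by measurable
  have "?N \<le> (\<integral>\<^sup>+x. ennreal (f x) \<partial>\<mu>)"
  proof (rule nn_integral_mono)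
    fix x assume x: "x \<in> space \<mu>"
    show "e2ennreal (- kl_integrand f f0 x) \<le> ennreal (f x)"
    proof (cases "f0 x = 0 \<or> f x = 0")
      case True
      then show ?thesis by (auto simp: kl_integrand_def e2ennreal_neg)
    next
      case False
      then have pos: "0 < f0 x" "0 < f x" using f_nonneg[OF x] f0_nonneg[OF x] by auto
      have "- (f0 x * ln (f0 x / f x)) = f0 x * ln (f x / f0 x)"
        using pos by (simp add: ln_div algebra_simps)
      also have "\<dots> \<le> f0 x * (f x / f0 x - 1)"
        using pos by (intro mult_left_mono ln_le_minus_one) auto
      also have "\<dots> \<le> f x" using pos by (simp add: field_simps)
      finally show ?thesis using False by (simp add: kl_integrand_def ennreal_leI)
    qed
  qed
  then have N: "?N \<noteq> top" using f by (auto simp: prob_densities_def top_unique)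
  have P: "?P \<noteq> top"
  proof
    assume "?P = top"
    moreover have "enn2ereal ?N \<noteq> \<infinity>" using N by (simp add: enn2ereal_eq_top_iff)
    ultimately have "kl_div \<mu> f f0 = \<infinity>" by (simp add: kl_div_def)
    with kl show False by simp
  qed
  have "AE x in \<mu>. e2ennreal (kl_integrand f f0 x) \<noteq> \<infinity>"
    using P by (intro nn_integral_noteq_infinite) auto
  with AE_space have pos: "AE x in \<mu>. 0 < f0 x \<longrightarrow> 0 < f x"
  proof eventually_elim
    case (elim x) then show ?case
      using f_nonneg[of x] by (auto simp: kl_integrand_def less_le split: if_splits)
  qed
  then show "AE x in D. 0 < f x" by (rule AE_D_I)
  from pos AE_space have kr: "AE x in \<mu>. kl_integrand f f0 x = ereal (r x)"
  proof eventually_elim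
    case (elim x) then show ?case
      using f0_nonneg[of x] by (auto simp: kl_integrand_def r_def less_le)
  qed
  have PN: "?P = (\<integral>\<^sup>+x. ennreal (r x) \<partial>\<mu>)" "?N = (\<integral>\<^sup>+x. ennreal (- r x) \<partial>\<mu>)"
    using kr by (auto intro!: nn_integral_cong_AE elim: eventually_mono)
  have ir: "integrable \<mu> r"
    using P N by (simp add: real_integrable_def PN)
  from integrableE[OF ir] obtain p q where pq: "0 \<le> p" "0 \<le> q"
    "?P = ennreal p" "?N = ennreal q" "integral\<^sup>L \<mu> r = p - q"
    unfolding PN by metis
  have "integral\<^sup>L \<mu> r < \<eta>"
    using kl pq by (simp add: kl_div_def enn2ereal_ennreal)
  have nn: "AE x in \<mu>. 0 \<le> f0 x" using f0_nonneg by auto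
  have lm: "(\<lambda>x. ln (f0 x / f x)) \<in> borel_measurable \<mu>" by measurable
  show "integrable D (\<lambda>x. ln (f0 x / f x))"
    unfolding D_def using ir by (subst integrable_density[OF lm f0_measurable nn]) (simp add: r_def[abs_def])
  show "(\<integral>x. ln (f0 x / f x) \<partial>D) < \<eta>"
    unfolding D_def using \<open>integral\<^sup>L \<mu> r < \<eta>\<close>
    by (subst integral_density[OF lm f0_measurable nn]) (simp add: r_def[abs_def])
qed

text \<open>The walk with steps $\ln(f_0/f) - \eta$ has negative drift, so it stays below some \<open>C\<close>, which means
$R_n(f) \ge e^{-C - n\eta}$.  Divergence to infinity is spelled out with countable quantifiers to make
its joint measurability in \<open>\<omega>\<close> and \<open>f\<close> evident.\<close>

lemma lik_ratio_lower_bound: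
  assumes f: "f \<in> prob_densities \<mu>" and \<eta>: "0 < \<eta>" and kl: "kl_div \<mu> f f0 < ereal \<eta>"
  shows "AE \<omega> in seq.S. \<forall>k::nat. \<exists>N. \<forall>n\<ge>N. real k \<le> exp (2 * \<eta>) ^ n * lik_ratio f0 n \<omega> f"
proof -
  note kl = kl_div_less_imp[OF f kl]
  have "AE \<omega> in seq.S. bdd_above (range (\<lambda>n. \<Sum>i<n. ln (f0 (\<omega> i) / f (\<omega> i)) - \<eta>))"
    using kl by (intro seq.negative_drift_walk_bdd_above) (simp_all add: D.prob_space)
  moreover have "AE \<omega> in seq.S. \<forall>i. 0 < f0 (\<omega> i) \<and> 0 < f (\<omega> i)"
    unfolding AE_all_countable
    using f0_pos_AE kl(1) by (intro allI seq.AE_component[of _ "\<lambda>x. 0 < f0 x \<and> 0 < f x"]) auto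
  ultimately show ?thesis
  proof eventually_elim
    case (elim \<omega>)
    then obtain C where C: "\<And>n. (\<Sum>i<n. ln (f0 (\<omega> i) / f (\<omega> i)) - \<eta>) \<le> C"
      by (auto simp: bdd_above_def)
    have ge: "exp (- C) * exp \<eta> ^ n \<le> exp (2 * \<eta>) ^ n * lik_ratio f0 n \<omega> f" for n
    proof -
      have "lik_ratio f0 n \<omega> f = exp (- (\<Sum>i<n. ln (f0 (\<omega> i) / f (\<omega> i))))"
        unfolding lik_ratio_def sum_negf[symmetric] exp_sum[OF finite_lessThan]
        using elim by (intro prod.cong) (simp_all add: exp_minus)
      moreover have "- C + real n * \<eta> \<le> real n * (2 * \<eta>) - (\<Sum>i<n. ln (f0 (\<omega> i) / f (\<omega> i)))"
        using C[of n] by (simp add: sum_subtractf algebra_simps)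
      ultimately show ?thesis
        by (simp add: exp_of_nat_mult[symmetric] exp_add[symmetric])
    qed
    have lim: "filterlim (\<lambda>n. exp (- C) * exp \<eta> ^ n) at_top sequentially"
    proof (rule filterlim_tendsto_pos_mult_at_top[OF tendsto_const])
      have "filterlim (\<lambda>n. \<eta> * real n) at_top sequentially"
        by (rule filterlim_tendsto_pos_mult_at_top[OF tendsto_const \<eta> filterlim_real_sequentially])
      from filterlim_compose[OF exp_at_top this]
      show "filterlim (\<lambda>n. exp \<eta> ^ n) at_top sequentially"
        by (simp add: exp_of_nat2_mult)
    qed simp
    show ?case
    proof
      fix k :: nat
      have "\<forall>\<^sub>F n in sequentially. real k \<le> exp (- C) * exp \<eta> ^ n"
        using lim by (simp add: filterlim_at_top)
      then show "\<exists>N. \<forall>n\<ge>N. real k \<le> exp (2 * \<eta>) ^ n * lik_ratio f0 n \<omega> f"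
        using ge by (auto simp: eventually_sequentially intro: order.trans)
    qed
  qed
qed

text \<open>By Fubini's theorem, almost every sample path is good for almost every \<open>f\<close> in the Kullback--Leibler
neighbourhood.  Along such a path Fatou's lemma, on a set of positive mass where the integrand diverges,
makes the integrals diverge.\<close>

lemma marginal_lower_bound:
  assumes Q: "mixing \<mu> Q" and kl: "kl_property \<mu> Q f0" and \<eta>: "0 < \<eta>"
  shows "AE \<omega> in seq.S. \<forall>\<^sub>F n in sequentially.
    1 < ennreal (exp (2 * \<eta>) ^ n) * (\<integral>\<^sup>+f. ennreal (lik_ratio f0 n \<omega> f) \<partial>Q)"
proof -
  interpret Q: finite_measure Q using Q by (simp add: mixing_def)
  interpret SQ: pair_sigma_finite seq.S Q ..
  define K where "K = {f \<in> space Q. kl_div \<mu> f f0 < ereal \<eta>}"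
  have K_pos: "0 < measure Q K" using kl \<eta> by (simp add: kl_property_def K_def)
  \<comment> \<open>A nonmeasurable set would have measure \<open>0\<close>.\<close>
  then have K[measurable]: "K \<in> sets Q" by (metis measure_notin_sets less_irrefl)
  let ?G = "\<lambda>\<omega> f. \<forall>k::nat. \<exists>N. \<forall>n\<ge>N. real k \<le> exp (2 * \<eta>) ^ n * lik_ratio f0 n \<omega> f"
  have [measurable]: "(\<lambda>p. lik_ratio f0 n (fst p) (snd p)) \<in> borel_measurable (seq.S \<Otimes>\<^sub>M Q)" for n
    using lik_ratio_measurable[OF Q] by (simp add: split_beta')
  have "AE f in Q. AE \<omega> in seq.S. f \<in> K \<longrightarrow> ?G \<omega> f"
  proof (rule AE_I2)
    fix f assume "f \<in> space Q"
    then show "AE \<omega> in seq.S. f \<in> K \<longrightarrow> ?G \<omega> f"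
      using Q lik_ratio_lower_bound[OF _ \<eta>, of f] by (cases "f \<in> K") (auto simp: mixing_def K_def)
  qed
  moreover have "{p \<in> space (seq.S \<Otimes>\<^sub>M Q). snd p \<in> K \<longrightarrow> ?G (fst p) (snd p)} \<in> sets (seq.S \<Otimes>\<^sub>M Q)"
    by measurable
  ultimately have "AE \<omega> in seq.S. AE f in Q. f \<in> K \<longrightarrow> ?G \<omega> f"
    by (subst SQ.AE_commute) auto
  with AE_space show ?thesis
  proof eventually_elim
    case (elim \<omega>)
    note [measurable] = lik_ratio_measurable_snd[OF Q elim(1)]
    let ?u = "\<lambda>n f. ennreal (exp (2 * \<eta>) ^ n * lik_ratio f0 n \<omega> f)"
    have "\<infinity> = (\<integral>\<^sup>+f. \<infinity> * indicator K f \<partial>Q)"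
      using K_pos by (subst nn_integral_cmult_indicator) (auto simp: Q.emeasure_eq_measure ennreal_top_mult)
    also have "\<dots> \<le> (\<integral>\<^sup>+f. liminf (\<lambda>n. ?u n f) \<partial>Q)"
    proof (rule nn_integral_mono_AE)
      show "AE f in Q. \<infinity> * indicator K f \<le> liminf (\<lambda>n. ?u n f)"
        using elim(2)
      proof eventually_elim
        case (elim f)
        show ?case
        proof (cases "f \<in> K")
          case True
          have "of_nat k \<le> liminf (\<lambda>n. ?u n f)" for k
          proof (rule Liminf_bounded)
            obtain N where "\<forall>n\<ge>N. real k \<le> exp (2 * \<eta>) ^ n * lik_ratio f0 n \<omega> f"
              using elim True by blast
            then show "\<forall>\<^sub>F n in sequentially. of_nat k \<le> ?u n f"
              unfolding eventually_sequentially ennreal_of_nat_eq_real_of_nat by (auto intro!: exI[of _ N] ennreal_leI)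
          qed
          then have "liminf (\<lambda>n. ?u n f) = top"
            by (metis ennreal_Ex_less_of_nat less_top linorder_not_le)
          then show ?thesis by simp
        qed simp
      qed
    qed
    also have "\<dots> \<le> liminf (\<lambda>n. \<integral>\<^sup>+f. ?u n f \<partial>Q)"
      by (rule nn_integral_liminf) measurable
    finally have "1 < liminf (\<lambda>n. \<integral>\<^sup>+f. ?u n f \<partial>Q)"
      by (simp add: top_unique)
    then have "\<forall>\<^sub>F n in sequentially. 1 < (\<integral>\<^sup>+f. ?u n f \<partial>Q)"
      by (rule less_LiminfD)
    moreover have "(\<integral>\<^sup>+f. ?u n f \<partial>Q) = ennreal (exp (2 * \<eta>) ^ n) * (\<integral>\<^sup>+f. ennreal (lik_ratio f0 n \<omega> f) \<partial>Q)" for n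
      by (simp add: ennreal_mult' nn_integral_cmult)
    ultimately show ?case by simp
  qed
qed

end

section \<open>Decay of the numerator over a countable cover\<close>

lemma nn_integral_count_space_summable_on:
  fixes g :: "'j \<Rightarrow> real"
  assumes J: "countable J" and nn: "\<And>j. j \<in> J \<Longrightarrow> 0 \<le> g j" and summ: "g summable_on J"
  shows "(\<integral>\<^sup>+j. ennreal (g j) \<partial>count_space J) \<noteq> \<infinity>"
proof (cases "finite J")
  case True
  then show ?thesis by (simp add: nn_integral_count_space_finite)
next
  case False
  then have "J \<noteq> {}" by auto
  note bij = bij_betw_from_nat_into[OF J False]
  have nn': "0 \<le> g (from_nat_into J n)" for n
    using nn from_nat_into[OF \<open>J \<noteq> {}\<close>] by auto
  have "(\<lambda>n. g (from_nat_into J n)) summable_on UNIV"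
    using summ summable_on_reindex_bij_betw[OF bij, of g] by simp
  then have "summable (\<lambda>n. g (from_nat_into J n))"
    by (rule summable_on_imp_summable)
  then have "(\<Sum>n. ennreal (g (from_nat_into J n))) \<noteq> top"
    by (rule ennreal_suminf_neq_top) (rule nn')
  then show ?thesis
    by (simp add: nn_integral_bij_count_space[OF bij, symmetric] nn_integral_count_space_nat)
qed

lemma ennreal_suminf_finite_tendsto_0:
  fixes T :: "nat \<Rightarrow> ennreal"
  assumes "(\<Sum>n. T n) \<noteq> \<infinity>" shows "T \<longlonglongrightarrow> 0"
proof -
  have T: "T n = ennreal (enn2real (T n))" for n
    using ennreal_suminf_lessD[of T top n] assms by (simp add: less_top)
  then have "summable (\<lambda>n. enn2real (T n))"
    using assms by (intro summable_suminf_not_top) auto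
  then have "(\<lambda>n. ennreal (enn2real (T n))) \<longlonglongrightarrow> ennreal 0"
    by (intro tendsto_ennrealI summable_LIMSEQ_zero)
  then show ?thesis using T by simp
qed

lemma borel_measurable_nn_integral_count_space:
  fixes F :: "'j \<Rightarrow> 'a \<Rightarrow> ennreal"
  assumes J: "countable J" and F: "\<And>j. j \<in> J \<Longrightarrow> F j \<in> borel_measurable M"
  shows "(\<lambda>x. \<integral>\<^sup>+j. F j x \<partial>count_space J) \<in> borel_measurable M"
proof -
  interpret sigma_finite_measure "count_space J" by (rule sigma_finite_measure_count_space_countable[OF J])
  have "(\<lambda>p. F (fst p) (snd p)) \<in> borel_measurable (count_space J \<Otimes>\<^sub>M M)"
    using F by (intro measurable_pair_measure_countable1[OF J]) simp
  from measurable_compose[OF measurable_pair_swap' this]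
  have "(\<lambda>(x, j). F j x) \<in> borel_measurable (M \<Otimes>\<^sub>M count_space J)"
    by (simp add: split_beta')
  then show ?thesis by (rule borel_measurable_nn_integral)
qed

context iid_model
begin

text \<open>With $L_{n,j}$ the likelihood integrated over $A_j$, the terms $e^{\eta n}\sqrt{L_{n,j}}$ have a finite
expected sum over \<open>n\<close> and \<open>j\<close>.  So their sum $T_n$ over \<open>j\<close> tends to \<open>0\<close> almost surely.
Once $T_n < 1$, every term is at most \<open>1\<close> and hence bounds its own square $e^{2\eta n} L_{n,j}$;
this passes from roots back to the integrals themselves.\<close>

lemma covered_marginal_decay:
  fixes J :: "'j set"
  assumes Prior: "prior_on \<mu> Prior" and de: "0 < \<delta>" "\<delta> < \<epsilon>" and J: "countable J"
    and fj: "\<And>j. j \<in> J \<Longrightarrow> fj j \<in> prob_densities \<mu> \<and> hell \<mu> (fj j) f0 > \<epsilon>"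
    and Aj: "\<And>j. j \<in> J \<Longrightarrow> Aj j \<in> sets Prior"
    and near: "\<And>j. j \<in> J \<Longrightarrow> Aj j \<subseteq> {f. hell \<mu> f (fj j) < \<delta>}"
    and cover: "A \<subseteq> (\<Union>j\<in>J. Aj j)"
    and summ: "(\<lambda>j. sqrt (measure Prior (Aj j))) summable_on J"
  obtains \<eta> :: real where "0 < \<eta>"
    and "AE \<omega> in seq.S. (\<lambda>n. ennreal (exp (2 * \<eta>) ^ n) *
      (\<integral>\<^sup>+f\<in>A. ennreal (lik_ratio f0 n \<omega> f) \<partial>Prior)) \<longlonglongrightarrow> 0"
proof -
  obtain \<gamma>' where \<gamma>': "0 < \<gamma>'" and sep': "\<And>p g q. \<lbrakk>unit_density \<mu> p; unit_density \<mu> g; unit_density \<mu> q;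
      hell \<mu> p g \<le> \<delta>; \<epsilon> < hell \<mu> g q\<rbrakk> \<Longrightarrow> \<gamma>' \<le> hell \<mu> p q"
    using hell_separation[OF de, where 'a = 'a] by metis
  \<comment> \<open>A separation below \<open>1\<close> keeps the logarithm of the rate \<open>1 - \<gamma>\<close> meaningful.\<close>
  define \<gamma> where "\<gamma> = min \<gamma>' (1 / 2)"
  have \<gamma>: "0 < \<gamma>" "\<gamma> \<le> 1 / 2" "\<gamma> \<le> \<gamma>'" using \<gamma>' by (auto simp: \<gamma>_def)
  \<comment> \<open>Half of the exponential rate: the factor \<open>exp \<eta>\<close> then leaves \<open>exp (- \<eta>)\<close> to sum over \<open>n\<close>.\<close>
  define \<eta> where "\<eta> = - ln (1 - \<gamma>) / 2"
  have \<eta>: "0 < \<eta>" using \<gamma> by (simp add: \<eta>_def)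
  have rate: "exp \<eta> * (1 - \<gamma>) = exp (- \<eta>)"
  proof -
    have "1 - \<gamma> = exp (- 2 * \<eta>)" using \<gamma> by (simp add: \<eta>_def)
    then show ?thesis by (simp add: exp_add[symmetric])
  qed
  interpret Prior: prob_space Prior using Prior by (simp add: prior_on_def)
  have mixP: "mixing \<mu> Prior"
    using Prior Prior.finite_measure_axioms by (simp add: prior_on_def mixing_def)
  define Q where "Q j = density Prior (indicator (Aj j))" for j
  have mixQ: "mixing \<mu> (Q j)" if "j \<in> J" for j
    unfolding Q_def using Aj[OF that] by (intro mixing_density[OF mixP]) auto
  have massQ: "measure (Q j) (space (Q j)) = measure Prior (Aj j)" if "j \<in> J" for j
    using Aj[OF that] sets.sets_into_space[OF Aj[OF that]]
    by (simp add: Q_def measure_def emeasure_density Int_absorb2 Int_absorb1 flip: indicator_inter_arith)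
  define L where "L n j \<omega> = (\<integral>\<^sup>+f. ennreal (lik_ratio f0 n \<omega> f) \<partial>Q j)" for n j \<omega>
  have L_meas: "L n j \<in> borel_measurable seq.S" if "j \<in> J" for n j
    unfolding L_def[abs_def] by (rule marginal_measurable[OF mixQ[OF that]])
  define T where "T n \<omega> = (\<integral>\<^sup>+j. ennreal (exp \<eta> ^ n) * ennsqrt (L n j \<omega>) \<partial>count_space J)" for n \<omega>
  have term_meas: "(\<lambda>\<omega>. ennreal (exp \<eta> ^ n) * ennsqrt (L n j \<omega>)) \<in> borel_measurable seq.S" if "j \<in> J" for n j
    by (intro borel_measurable_times_ennreal borel_measurable_const measurable_compose[OF L_meas[OF that] ennsqrt_measurable])
  have T_meas: "T n \<in> borel_measurable seq.S" for n
    unfolding T_def[abs_def] by (intro borel_measurable_nn_integral_count_space J term_meas)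
  define R where "R = (\<integral>\<^sup>+j. ennreal (sqrt (measure Prior (Aj j))) \<partial>count_space J)"
  have R: "R \<noteq> \<infinity>"
    unfolding R_def by (rule nn_integral_count_space_summable_on[OF J _ summ]) simp
  have ET: "(\<integral>\<^sup>+\<omega>. T n \<omega> \<partial>seq.S) \<le> ennreal (exp (- \<eta>) ^ n) * R" for n
  proof -
    have "(\<integral>\<^sup>+\<omega>. T n \<omega> \<partial>seq.S) = (\<integral>\<^sup>+j. \<integral>\<^sup>+\<omega>. ennreal (exp \<eta> ^ n) * ennsqrt (L n j \<omega>) \<partial>seq.S \<partial>count_space J)"
      unfolding T_def by (rule nn_integral_count_space_nn_integral[OF J term_meas])
    also have "\<dots> \<le> (\<integral>\<^sup>+j. ennreal (exp (- \<eta>) ^ n) * ennreal (sqrt (measure Prior (Aj j))) \<partial>count_space J)"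
    proof (rule nn_integral_mono)
      fix j assume "j \<in> space (count_space J)"
      then have j: "j \<in> J" by simp
      note g = unit_density_prob_densities[OF conjunct1[OF fj[OF j]]]
      have nearQ: "AE f in Q j. hell \<mu> f (fj j) \<le> \<delta>"
        unfolding Q_def using near[OF j] Aj[OF j]
        by (subst AE_density) (auto simp: indicator_def intro!: AE_I2 less_imp_le)
      have sep: "\<gamma> \<le> hell \<mu> p f0" if "unit_density \<mu> p" "hell \<mu> p (fj j) \<le> \<delta>" for p
        using sep'[OF that(1) g unit_density_prob_densities[OF f0] that(2)] fj[OF j] \<gamma> by auto
      have "(\<integral>\<^sup>+\<omega>. ennreal (exp \<eta> ^ n) * ennsqrt (L n j \<omega>) \<partial>seq.S)
          = ennreal (exp \<eta> ^ n) * (\<integral>\<^sup>+\<omega>. ennsqrt (L n j \<omega>) \<partial>seq.S)"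
        by (rule nn_integral_cmult) (rule measurable_compose[OF L_meas[OF j] ennsqrt_measurable])
      also have "\<dots> \<le> ennreal (exp \<eta> ^ n) * ennreal ((1 - \<gamma>) ^ n * sqrt (measure Prior (Aj j)))"
        using expectation_sqrt_marginal_le[OF mixQ[OF j] g nearQ sep, of n] \<gamma>
        unfolding L_def massQ[OF j] by (intro mult_left_mono) auto
      also have "\<dots> = ennreal ((exp \<eta> * (1 - \<gamma>)) ^ n * sqrt (measure Prior (Aj j)))"
        by (simp add: ennreal_mult'[symmetric] power_mult_distrib mult.assoc)
      also have "\<dots> = ennreal (exp (- \<eta>) ^ n) * ennreal (sqrt (measure Prior (Aj j)))"
        unfolding rate by (simp add: ennreal_mult')
      finally show "(\<integral>\<^sup>+\<omega>. ennreal (exp \<eta> ^ n) * ennsqrt (L n j \<omega>) \<partial>seq.S)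
          \<le> ennreal (exp (- \<eta>) ^ n) * ennreal (sqrt (measure Prior (Aj j)))" .
    qed
    also have "\<dots> = ennreal (exp (- \<eta>) ^ n) * R"
      unfolding R_def by (rule nn_integral_cmult) simp
    finally show ?thesis .
  qed
  have "(\<integral>\<^sup>+\<omega>. (\<Sum>n. T n \<omega>) \<partial>seq.S) = (\<Sum>n. \<integral>\<^sup>+\<omega>. T n \<omega> \<partial>seq.S)"
    by (rule nn_integral_suminf) (rule T_meas)
  also have "\<dots> \<le> (\<Sum>n. ennreal (exp (- \<eta>) ^ n) * R)"
    by (intro suminf_le ET) auto
  also have "\<dots> = (\<Sum>n. ennreal (exp (- \<eta>) ^ n)) * R" by simp
  also have "\<dots> < \<infinity>"
  proof -
    have "(\<Sum>n. ennreal (exp (- \<eta>) ^ n)) \<noteq> top"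
      using \<eta> by (intro ennreal_suminf_neq_top summable_geometric) auto
    then show ?thesis using R by (simp add: ennreal_mult_less_top less_top)
  qed
  finally have "AE \<omega> in seq.S. (\<Sum>n. T n \<omega>) \<noteq> \<infinity>"
    using T_meas by (intro nn_integral_noteq_infinite) auto
  with AE_space have "AE \<omega> in seq.S. (\<lambda>n. ennreal (exp (2 * \<eta>) ^ n) *
      (\<integral>\<^sup>+f\<in>A. ennreal (lik_ratio f0 n \<omega> f) \<partial>Prior)) \<longlonglongrightarrow> 0"
  proof eventually_elim
    case (elim \<omega>)
    have lim: "(\<lambda>n. T n \<omega>) \<longlonglongrightarrow> 0"
      by (rule ennreal_suminf_finite_tendsto_0) (rule elim(2))
    have sq: "ennreal (exp (2 * \<eta>) ^ n) * L n j \<omega> = (ennreal (exp \<eta> ^ n) * ennsqrt (L n j \<omega>))\<^sup>2" for n j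
    proof -
      have "exp (2 * \<eta>) ^ n = (exp \<eta> ^ n)\<^sup>2"
        by (metis exp_double power_mult mult.commute)
      then show ?thesis by (simp add: power_mult_distrib ennsqrt_power2 ennreal_power)
    qed
    have le_L: "(\<integral>\<^sup>+f\<in>A. ennreal (lik_ratio f0 n \<omega> f) \<partial>Prior) \<le> (\<integral>\<^sup>+j. L n j \<omega> \<partial>count_space J)" for n
    proof -
      note [measurable] = lik_ratio_measurable_snd[OF mixP elim(1)]
      have "(\<integral>\<^sup>+f\<in>A. ennreal (lik_ratio f0 n \<omega> f) \<partial>Prior)
          \<le> (\<integral>\<^sup>+f. \<integral>\<^sup>+j. indicator (Aj j) f * ennreal (lik_ratio f0 n \<omega> f) \<partial>count_space J \<partial>Prior)"
      proof (rule nn_integral_mono)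
        fix f
        show "ennreal (lik_ratio f0 n \<omega> f) * indicator A f
            \<le> (\<integral>\<^sup>+j. indicator (Aj j) f * ennreal (lik_ratio f0 n \<omega> f) \<partial>count_space J)"
        proof (cases "f \<in> A")
          case True
          then obtain j where "j \<in> J" "f \<in> Aj j" using cover by auto
          then show ?thesis
            using nn_integral_ge_point[of j J "\<lambda>j. indicator (Aj j) f * ennreal (lik_ratio f0 n \<omega> f)"] True
            by simp
        qed simp
      qed
      also have "\<dots> = (\<integral>\<^sup>+j. \<integral>\<^sup>+f. indicator (Aj j) f * ennreal (lik_ratio f0 n \<omega> f) \<partial>Prior \<partial>count_space J)"
      proof (rule nn_integral_count_space_nn_integral[OF J])
        fix j assume "j \<in> J"
        note [measurable] = Aj[OF this]
        show "(\<lambda>f. indicator (Aj j) f * ennreal (lik_ratio f0 n \<omega> f)) \<in> borel_measurable Prior"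
          by measurable
      qed
      also have "\<dots> = (\<integral>\<^sup>+j. L n j \<omega> \<partial>count_space J)"
        using Aj by (intro nn_integral_cong) (simp add: L_def Q_def nn_integral_density)
      finally show ?thesis .
    qed
    have le_T: "ennreal (exp (2 * \<eta>) ^ n) * (\<integral>\<^sup>+f\<in>A. ennreal (lik_ratio f0 n \<omega> f) \<partial>Prior) \<le> T n \<omega>"
      if small: "T n \<omega> < 1" for n
    proof -
      have "ennreal (exp (2 * \<eta>) ^ n) * (\<integral>\<^sup>+f\<in>A. ennreal (lik_ratio f0 n \<omega> f) \<partial>Prior)
          \<le> ennreal (exp (2 * \<eta>) ^ n) * (\<integral>\<^sup>+j. L n j \<omega> \<partial>count_space J)"
        by (intro mult_left_mono le_L) simp
      also have "\<dots> = (\<integral>\<^sup>+j. ennreal (exp (2 * \<eta>) ^ n) * L n j \<omega> \<partial>count_space J)"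
        by (rule nn_integral_cmult[symmetric]) simp
      also have "\<dots> \<le> T n \<omega>"
        unfolding T_def
      proof (rule nn_integral_mono)
        fix j assume "j \<in> space (count_space J)"
        then have "ennreal (exp \<eta> ^ n) * ennsqrt (L n j \<omega>) \<le> T n \<omega>"
          unfolding T_def by (intro nn_integral_ge_point) simp
        then have "ennreal (exp \<eta> ^ n) * ennsqrt (L n j \<omega>) \<le> 1"
          using small by simp
        then show "ennreal (exp (2 * \<eta>) ^ n) * L n j \<omega> \<le> ennreal (exp \<eta> ^ n) * ennsqrt (L n j \<omega>)"
          unfolding sq power2_eq_square by (metis mult_left_mono mult.right_neutral zero_le)
      qed
      finally show ?thesis .
    qed
    have "\<forall>\<^sub>F n in sequentially. T n \<omega> < 1"
      by (rule order_tendstoD(2)[OF lim]) simp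
    then have "\<forall>\<^sub>F n in sequentially. ennreal (exp (2 * \<eta>) ^ n) *
        (\<integral>\<^sup>+f\<in>A. ennreal (lik_ratio f0 n \<omega> f) \<partial>Prior) \<le> T n \<omega>"
      by eventually_elim (rule le_T)
    then show ?case
      by (intro tendsto_sandwich[OF _ _ tendsto_const lim]) auto
  qed
  with \<eta> show ?thesis by (rule that)
qed

end

section \<open>Posterior consistency\<close>

lemma ennreal_divide_le_mult:
  fixes a b c :: ennreal
  assumes "1 \<le> c * b" shows "a / b \<le> c * a"
proof -
  have "inverse b \<le> c"
  proof (cases "c = top")
    case False
    have "inverse b = 1 * inverse b" by simp
    also have "\<dots> \<le> c * b * inverse b" using assms by (rule mult_right_mono) simp
    also have "\<dots> \<le> c"
    proof (cases "b = top")
      case False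
      moreover have "b \<noteq> 0" using assms by auto
      ultimately show ?thesis
        by (simp add: mult_divide_eq_ennreal flip: divide_ennreal_def)
    qed simp
    finally show ?thesis .
  qed simp
  then show ?thesis
    by (simp add: divide_ennreal_def mult.commute mult_left_mono)
qed

theorem theorem4:
  fixes X :: "'a::euclidean_space set"
    and \<mu> :: "'a measure"
    and f0 :: "'a \<Rightarrow> real"
    and Prior :: "('a \<Rightarrow> real) measure"
    and \<delta> \<epsilon> :: real
    and J :: "'j set"
    and fj :: "'j \<Rightarrow> 'a \<Rightarrow> real"
    and Aj :: "'j \<Rightarrow> ('a \<Rightarrow> real) set"
    and A :: "('a \<Rightarrow> real) set"
  assumes "X \<in> sets borel"
    and "\<mu> = restrict_space lborel X"
    and "f0 \<in> prob_densities \<mu>"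
    and "prior_on \<mu> Prior"
    and "0 < \<delta>" and "\<delta> < \<epsilon>"
    and "A = {f \<in> space Prior. hell \<mu> f f0 > \<epsilon>}"
    and "countable J"
    and "\<And>j. j \<in> J \<Longrightarrow> fj j \<in> prob_densities \<mu> \<and> hell \<mu> (fj j) f0 > \<epsilon>"
    and "\<And>j. j \<in> J \<Longrightarrow> Aj j \<in> sets Prior"
    and "disjoint_family_on Aj J"
    and "A \<subseteq> (\<Union>j\<in>J. Aj j)"
    and "\<And>j. j \<in> J \<Longrightarrow> Aj j \<subseteq> {f. hell \<mu> f (fj j) < \<delta>}"
    and "kl_property \<mu> Prior f0"
    and "(\<lambda>j. sqrt (measure Prior (Aj j))) summable_on J"
  shows "AE \<omega> in (\<Pi>\<^sub>M i\<in>(UNIV::nat set). density \<mu> (\<lambda>x. ennreal (f0 x))).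
           (\<lambda>n. posterior Prior f0 n \<omega> A) \<longlonglongrightarrow> 0"
proof -
  have "sigma_finite_measure \<mu>"
    unfolding assms(2) using assms(1)
    by (intro sigma_finite_measure_restrict_space lborel.sigma_finite_measure_axioms) simp
  then interpret iid_model \<mu> f0
    using assms(3) by (simp add: iid_model_def iid_model_axioms_def)
  have Prior: "mixing \<mu> Prior"
    using assms(4) by (simp add: prior_on_def mixing_def prob_space.finite_measure)
  obtain \<eta> where \<eta>: "0 < \<eta>"
    and num: "AE \<omega> in seq.S. (\<lambda>n. ennreal (exp (2 * \<eta>) ^ n) *
      (\<integral>\<^sup>+f\<in>A. ennreal (lik_ratio f0 n \<omega> f) \<partial>Prior)) \<longlonglongrightarrow> 0"
    using covered_marginal_decay[OF assms(4,5,6,8,9,10,13,12,15)] by blast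
  have "AE \<omega> in seq.S. (\<lambda>n. posterior Prior f0 n \<omega> A) \<longlonglongrightarrow> 0"
    using num marginal_lower_bound[OF Prior assms(14) \<eta>]
  proof eventually_elim
    case (elim \<omega>)
    have "\<forall>\<^sub>F n in sequentially. posterior Prior f0 n \<omega> A \<le>
        ennreal (exp (2 * \<eta>) ^ n) * (\<integral>\<^sup>+f\<in>A. ennreal (lik_ratio f0 n \<omega> f) \<partial>Prior)"
      using elim(2) by eventually_elim (simp add: posterior_def ennreal_divide_le_mult)
    then show ?case
      by (intro tendsto_sandwich[OF _ _ tendsto_const elim(1)]) auto
  qed
  then show ?thesis by (simp only: D_def)
qed

end
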